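(* Let $\mathscr{H}_1,\dots,\mathscr{H}_n$ be complex Hilbert spaces and let $A=[A_{ij}]_{i,j=1}^n$ be a bounded linear operator on $\bigoplus_{i=1}^n\mathscr{H}_i$, written as an $n\times n$ operator matrix with $A_{ij}:\mathscr{H}_j\to\mathscr{H}_i$. Let $f,g$ be nonnegative continuous functions on $[0,\infty)$ satisfying $f(t)g(t)=t$ for all $t\ge0$. Then $$w(A)\le w([a_{ij}]),$$ where $[a_{ij}]$ is the $n\times n$ real matrix with $a_{ii}=\frac14B_{ii}$, $a_{ij}=\|A_{ij}\|$ for $i\ne j$, and $$B_{ii}=\|f^2(|A_{ii}|)\|+\|g^2(|A_{ii}^*|)\|+\sqrt{\big(\|f^2(|A_{ii}|)\|-\|g^2(|A_{ii}^*|)\|\big)^2+4\,\|f(|A_{ii}|)\,g(|A_{ii}^*|)\|^2}.$$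
   Context: $w(X)=\sup_{\|x\|=1}|\langle Xx,x\rangle|$ is the numerical radius (for an $n\times n$ matrix, regarded as an operator on $\mathbb{C}^n$), and $\|\cdot\|$ is the operator norm. For a bounded operator $X$, $|X|=(X^*X)^{1/2}$. Functions of positive operators are defined by the continuous functional calculus, and $f^{2}(|X|)$ means $(f(|X|))^{2}$. *)

theory Defs
  imports "HOL-Analysis.Analysis" "HOL-Computational_Algebra.Polynomial"
begin

text \<open>
  Complex Hilbert spaces, as a refinement of the real ones of the library: the real inner product
  is the real part of the complex one. The complex inner product is linear in its first argument.
\<close>

class complex_hilbert = real_inner + banach +
  fixes scaleC :: "complex \<Rightarrow> 'a \<Rightarrow> 'a" (infixr "*\<^sub>C" 75)
    and cinner :: "'a \<Rightarrow> 'a \<Rightarrow> complex"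
  assumes scaleC_add_right: "c *\<^sub>C (x + y) = c *\<^sub>C x + c *\<^sub>C y"
    and scaleC_add_left: "(c + d) *\<^sub>C x = c *\<^sub>C x + d *\<^sub>C x"
    and scaleC_scaleC: "c *\<^sub>C d *\<^sub>C x = (c * d) *\<^sub>C x"
    and scaleC_of_real: "complex_of_real r *\<^sub>C x = r *\<^sub>R x"
    and cinner_add_left: "cinner (x + y) z = cinner x z + cinner y z"
    and cinner_scaleC_left: "cinner (c *\<^sub>C x) y = c * cinner x y"
    and cinner_commute: "cinner x y = cnj (cinner y x)"
    and Re_cinner: "Re (cinner x y) = inner x y"

instantiation complex :: complex_hilbert
begin

definition scaleC_complex :: "complex \<Rightarrow> complex \<Rightarrow> complex"
  where "scaleC_complex c x = c * x"

definition cinner_complex :: "complex \<Rightarrow> complex \<Rightarrow> complex"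
  where "cinner_complex x y = x * cnj y"

instance
  by standard
    (simp_all add: scaleC_complex_def cinner_complex_def inner_complex_def algebra_simps
      scaleR_conv_of_real)

end

instantiation vec :: (complex_hilbert, finite) complex_hilbert
begin

definition scaleC_vec :: "complex \<Rightarrow> 'a ^ 'b \<Rightarrow> 'a ^ 'b"
  where "scaleC_vec c x = (\<chi> i. c *\<^sub>C x $ i)"

definition cinner_vec :: "'a ^ 'b \<Rightarrow> 'a ^ 'b \<Rightarrow> complex"
  where "cinner_vec x y = (\<Sum>i\<in>UNIV. cinner (x $ i) (y $ i))"

instance
proof
  fix c d :: complex and r :: real and x y z :: "'a ^ 'b"
  show "c *\<^sub>C (x + y) = c *\<^sub>C x + c *\<^sub>C y"
    by (simp add: scaleC_vec_def vec_eq_iff scaleC_add_right)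
  show "(c + d) *\<^sub>C x = c *\<^sub>C x + d *\<^sub>C x"
    by (simp add: scaleC_vec_def vec_eq_iff scaleC_add_left)
  show "c *\<^sub>C d *\<^sub>C x = (c * d) *\<^sub>C x"
    by (simp add: scaleC_vec_def vec_eq_iff scaleC_scaleC)
  show "complex_of_real r *\<^sub>C x = r *\<^sub>R x"
    by (simp add: scaleC_vec_def vec_eq_iff scaleC_of_real)
  show "cinner (x + y) z = cinner x z + cinner y z"
    by (simp add: cinner_vec_def cinner_add_left sum.distrib)
  show "cinner (c *\<^sub>C x) y = c * cinner x y"
    by (simp add: cinner_vec_def scaleC_vec_def cinner_scaleC_left sum_distrib_left)
  show "cinner x y = cnj (cinner y x)"
    unfolding cinner_vec_def cnj_sum by (intro sum.cong refl cinner_commute)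
  show "Re (cinner x y) = inner x y"
    by (simp add: cinner_vec_def inner_vec_def Re_cinner)
qed

end

text \<open>
  A Hilbert space is rendered as a closed complex subspace of an arbitrary ambient Hilbert space.
  This makes families of different spaces expressible and loses no generality: any family of
  Hilbert spaces embeds isometrically in a common one. An operator between such spaces is a total
  function of which only the values on its domain matter; nothing below depends on the
  orthogonal complement of the space.
\<close>

definition hilbert_subspace :: "'a::complex_hilbert set \<Rightarrow> bool" where
  "hilbert_subspace H \<longleftrightarrow> closed H \<and> 0 \<in> H \<and>
     (\<forall>x\<in>H. \<forall>y\<in>H. x + y \<in> H) \<and> (\<forall>c. \<forall>x\<in>H. c *\<^sub>C x \<in> H)"

definition bounded_op :: "'a::complex_hilbert set \<Rightarrow> 'b::complex_hilbert set \<Rightarrow> ('a \<Rightarrow> 'b) \<Rightarrow> bool"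
  where "bounded_op H K T \<longleftrightarrow> T \<in> H \<rightarrow> K \<and>
     (\<forall>x\<in>H. \<forall>y\<in>H. T (x + y) = T x + T y) \<and>
     (\<forall>c. \<forall>x\<in>H. T (c *\<^sub>C x) = c *\<^sub>C T x) \<and>
     (\<exists>B. \<forall>x\<in>H. norm (T x) \<le> B * norm x)"

definition op_norm :: "'a::complex_hilbert set \<Rightarrow> ('a \<Rightarrow> 'b::complex_hilbert) \<Rightarrow> real" where
  "op_norm H T = Sup {norm (T x) | x. x \<in> H \<and> norm x \<le> 1}"

text \<open>
  The element 0 is inserted only to fix the value 0 for the zero space, which has no unit vectors;
  all the other elements of the set are nonnegative.
\<close>

definition numerical_radius :: "'a::complex_hilbert set \<Rightarrow> ('a \<Rightarrow> 'a) \<Rightarrow> real" where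
  "numerical_radius H T = Sup (insert 0 {cmod (cinner (T x) x) | x. x \<in> H \<and> norm x = 1})"

text \<open>The adjoint of \<open>T : H \<rightarrow> K\<close>, to be applied to elements of \<open>K\<close>.\<close>

definition op_adjoint ::
  "'a::complex_hilbert set \<Rightarrow> ('a \<Rightarrow> 'b::complex_hilbert) \<Rightarrow> 'b \<Rightarrow> 'a" where
  "op_adjoint H T y = (THE x. x \<in> H \<and> (\<forall>z\<in>H. cinner (T z) y = cinner z x))"

definition op_spectrum :: "'a::complex_hilbert set \<Rightarrow> ('a \<Rightarrow> 'a) \<Rightarrow> complex set" where
  "op_spectrum H T = {z. \<not> (\<exists>S. bounded_op H H S \<and>
     (\<forall>x\<in>H. S (T x - z *\<^sub>C x) = x \<and> T (S x) - z *\<^sub>C S x = x))}"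

definition op_poly :: "real poly \<Rightarrow> ('a::complex_hilbert \<Rightarrow> 'a) \<Rightarrow> 'a \<Rightarrow> 'a" where
  "op_poly p T x = (\<Sum>k\<le>degree p. coeff p k *\<^sub>R (T ^^ k) x)"

text \<open>
  Continuous functional calculus for a self-adjoint operator \<open>T\<close> on \<open>H\<close> (whose spectrum is real)
  and a real function \<open>f\<close> continuous on the spectrum: \<open>f(T)\<close> is the limit in operator norm
  of \<open>p\<^sub>n(T)\<close> for polynomials \<open>p\<^sub>n\<close> converging to \<open>f\<close> uniformly on the spectrum. Extensionality makes
  \<open>f(T)\<close> unique as a total function.
\<close>

definition op_fun ::
  "'a::complex_hilbert set \<Rightarrow> (real \<Rightarrow> real) \<Rightarrow> ('a \<Rightarrow> 'a) \<Rightarrow> 'a \<Rightarrow> 'a" where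
  "op_fun H f T = (THE S. bounded_op H H S \<and> S \<in> extensional H \<and>
     (\<exists>p :: nat \<Rightarrow> real poly.
        uniform_limit {t. complex_of_real t \<in> op_spectrum H T} (\<lambda>n. poly (p n)) f sequentially \<and>
        (\<lambda>n. op_norm H (\<lambda>x. op_poly (p n) T x - S x)) \<longlonglongrightarrow> 0))"

definition op_abs :: "'a::complex_hilbert set \<Rightarrow> ('a \<Rightarrow> 'b::complex_hilbert) \<Rightarrow> 'a \<Rightarrow> 'a" where
  "op_abs H T = op_fun H sqrt (op_adjoint H T \<circ> T)"

definition hilbert_sum :: "('n::finite \<Rightarrow> 'a::complex_hilbert set) \<Rightarrow> ('a ^ 'n) set" where
  "hilbert_sum H = {x. \<forall>i. x $ i \<in> H i}"

definition op_entry :: "('a::complex_hilbert ^ 'n::finite \<Rightarrow> 'a ^ 'n) \<Rightarrow> 'n \<Rightarrow> 'n \<Rightarrow> 'a \<Rightarrow> 'a" where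
  "op_entry A i j x = A (axis j x) $ i"

definition diag_bound ::
  "'a::complex_hilbert set \<Rightarrow> (real \<Rightarrow> real) \<Rightarrow> (real \<Rightarrow> real) \<Rightarrow> ('a \<Rightarrow> 'a) \<Rightarrow> real" where
  "diag_bound H f g X =
    (let F = op_fun H f (op_abs H X);
         G = op_fun H g (op_abs H (op_adjoint H X))
     in op_norm H (F \<circ> F) + op_norm H (G \<circ> G) +
        sqrt ((op_norm H (F \<circ> F) - op_norm H (G \<circ> G))\<^sup>2 + 4 * (op_norm H (F \<circ> G))\<^sup>2))"

end

theory Submission
  imports Defs "HOL-Computational_Algebra.Fundamental_Theorem_Algebra"
begin

text \<open>
  For a unit vector \<open>x\<close> of the direct sum, \<open>\<bar>\<langle>A x, x\<rangle>\<bar>\<close> is at most the sum of the numbers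
  \<open>\<bar>\<langle>A\<^sub>i\<^sub>j x\<^sub>j, x\<^sub>i\<rangle>\<bar>\<close>. If each of these is at most \<open>a\<^sub>i\<^sub>j \<parallel>x\<^sub>i\<parallel> \<parallel>x\<^sub>j\<parallel>\<close>, the sum is the value of the
  quadratic form of \<open>[a\<^sub>i\<^sub>j]\<close> at the unit vector \<open>(\<parallel>x\<^sub>i\<parallel>)\<^sub>i\<close>, hence at most the numerical radius of
  \<open>[a\<^sub>i\<^sub>j]\<close> (\<open>numerical_radius_le_matrix\<close>). Off the diagonal the bound is the Cauchy-Schwarz inequality.

  On the diagonal put \<open>X = A\<^sub>i\<^sub>i\<close>, \<open>F = f(\<bar>X\<bar>)\<close> and \<open>G = g(\<bar>X*\<bar>)\<close>. The mixed Schwarz inequality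
  \<open>\<bar>\<langle>X x, y\<rangle>\<bar> \<le> \<parallel>F x\<parallel> \<parallel>G y\<parallel>\<close> (\<open>mixed_schwarz\<close>) and the arithmetic-geometric mean inequality give
  \<open>\<bar>\<langle>X x, x\<rangle>\<bar> \<le> (\<parallel>F x\<parallel>\<^sup>2 + \<parallel>G x\<parallel>\<^sup>2) / 2\<close>. The sum in parentheses is \<open>\<langle>(F\<^sup>2 + G\<^sup>2) x, x\<rangle>\<close>, and
  \<open>\<parallel>F\<^sup>2 + G\<^sup>2\<parallel>\<close> is at most the largest eigenvalue of the matrix with diagonal \<open>\<parallel>F\<^sup>2\<parallel>\<close>, \<open>\<parallel>G\<^sup>2\<parallel>\<close> and
  off-diagonal entries \<open>\<parallel>F G\<parallel>\<close> (\<open>norm_sum_squares_le\<close>), which is half of the number \<open>B\<^sub>i\<^sub>i\<close>.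

  The operators \<open>F\<close> and \<open>G\<close> are given by the continuous functional calculus, whose defining property
  has to be shown to have exactly one solution. For a symmetric operator \<open>T\<close> and a real polynomial
  \<open>r\<close>, the norm of \<open>r(T)\<close> is at most the supremum of \<open>\<bar>r\<bar>\<close> on the real spectrum
  (\<open>op_poly_norm_le\<close>). This yields uniqueness; existence follows from the Weierstrass theorem, since
  the real spectrum of a positive operator lies in an interval \<open>[0, M]\<close> (\<open>positive_op_spectrum\<close>).
  Then \<open>f(T)\<close> is a strong limit of polynomials in \<open>T\<close> (\<open>op_fun_limit\<close>), so that multiplicativity and
  the rule \<open>X f(T) = f(R) X\<close> for \<open>X T = R X\<close> carry over from polynomials.
\<close>

section \<open>Complex inner product spaces\<close>

lemma scaleC_1 [simp]: "1 *\<^sub>C x = (x::'a::complex_hilbert)"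
  using scaleC_of_real[of 1 x] by simp

lemma scaleC_zero_right [simp]: "c *\<^sub>C 0 = (0::'a::complex_hilbert)"
  using scaleC_add_right[of c 0 "0::'a"] by simp

lemma scaleC_scaleR: "c *\<^sub>C (r *\<^sub>R x) = r *\<^sub>R (c *\<^sub>C (x::'a::complex_hilbert))"
  by (metis scaleC_of_real mult.commute scaleC_scaleC)

lemma cinner_scaleC_right: "cinner x (c *\<^sub>C y) = cnj c * cinner x (y::'a::complex_hilbert)"
  by (metis cinner_commute cinner_scaleC_left complex_cnj_mult)

lemma cinner_conv_inner:
  "cinner x y = Complex (inner x y) (inner x (\<i> *\<^sub>C (y::'a::complex_hilbert)))"
proof -
  have "Re (cinner x (\<i> *\<^sub>C y)) = Im (cinner x y)"
    by (simp add: cinner_scaleC_right)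
  then show ?thesis by (simp add: Re_cinner complex_eq_iff)
qed

lemma inner_ii_left: "inner (\<i> *\<^sub>C x) y = - inner x (\<i> *\<^sub>C (y::'a::complex_hilbert))"
  using Re_cinner[of "\<i> *\<^sub>C x" y] cinner_conv_inner[of x y] by (simp add: cinner_scaleC_left)

lemma cinner_self: "cinner x x = complex_of_real ((norm (x::'a::complex_hilbert))\<^sup>2)"
proof -
  have "Im (cinner x x) = 0"
    using arg_cong[OF cinner_commute[of x x], of Im] by simp
  then show ?thesis by (simp add: complex_eq_iff Re_cinner power2_norm_eq_inner)
qed

lemma norm_scaleC: "norm (c *\<^sub>C x) = cmod c * norm (x::'a::complex_hilbert)"
proof -
  have "complex_of_real ((norm (c *\<^sub>C x))\<^sup>2) = (c * cnj c) * complex_of_real ((norm x)\<^sup>2)"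
    unfolding cinner_self[symmetric] by (simp add: cinner_scaleC_left cinner_scaleC_right)
  also have "\<dots> = complex_of_real ((cmod c * norm x)\<^sup>2)"
    by (simp add: complex_norm_square[symmetric] power_mult_distrib)
  finally have "(norm (c *\<^sub>C x))\<^sup>2 = (cmod c * norm x)\<^sup>2"
    using of_real_eq_iff by blast
  then show ?thesis by (simp add: power2_eq_iff_nonneg)
qed

lemma bounded_linear_scaleC: "bounded_linear (\<lambda>x::'a::complex_hilbert. c *\<^sub>C x)"
  by (rule bounded_linear_intro[of _ "cmod c"])
    (simp_all add: scaleC_add_right scaleC_scaleR norm_scaleC)

text \<open>Bounds for real inner products become bounds for complex ones by rotating the first vector.\<close>

lemma cmod_cinner_le_by_rotation:
  fixes x y :: "'a::complex_hilbert"
  assumes "\<And>c. cmod c = 1 \<Longrightarrow> inner (c *\<^sub>C x) y \<le> B"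
  shows "cmod (cinner x y) \<le> B"
proof -
  define z where "z = cinner x y"
  define c where "c = (if z = 0 then 1 else cnj (sgn z))"
  have "cmod c = 1" by (simp add: c_def norm_sgn)
  moreover have "c * z = complex_of_real (cmod z)"
  proof (cases "z = 0")
    case False
    have "c * z = (z * cnj z) / complex_of_real (cmod z)"
      using False by (simp add: c_def sgn_eq)
    also have "\<dots> = complex_of_real (cmod z)"
      using False by (simp add: complex_norm_square[symmetric] power2_eq_square)
    finally show ?thesis .
  qed simp
  then have "inner (c *\<^sub>C x) y = cmod z"
    by (simp add: Re_cinner[symmetric] cinner_scaleC_left z_def)
  ultimately show ?thesis using assms z_def by metis
qed

lemma cmod_cinner_le: "cmod (cinner x y) \<le> norm x * norm (y::'a::complex_hilbert)"
  by (rule cmod_cinner_le_by_rotation) (metis norm_cauchy_schwarz norm_scaleC mult_1)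

section \<open>Closed subspaces and bounded operators\<close>

context
  fixes H :: "'a::complex_hilbert set"
  assumes H: "hilbert_subspace H"
begin

lemma hs_0: "0 \<in> H" and hs_closed: "closed H"
  and hs_add: "x \<in> H \<Longrightarrow> y \<in> H \<Longrightarrow> x + y \<in> H"
  and hs_scaleC: "x \<in> H \<Longrightarrow> c *\<^sub>C x \<in> H"
  using H by (auto simp: hilbert_subspace_def)

lemma hs_scaleR: "x \<in> H \<Longrightarrow> r *\<^sub>R x \<in> H"
  using hs_scaleC[of x "complex_of_real r"] by (simp add: scaleC_of_real)

lemma hs_minus: "x \<in> H \<Longrightarrow> - x \<in> H"
  using hs_scaleR[of x "- 1"] by simp

lemma hs_diff: "x \<in> H \<Longrightarrow> y \<in> H \<Longrightarrow> x - y \<in> H"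
  using hs_add[OF _ hs_minus, of x y] by simp

lemma hs_lim: "(\<And>n. X n \<in> H) \<Longrightarrow> X \<longlonglongrightarrow> x \<Longrightarrow> x \<in> H"
  using hs_closed closed_sequentially by blast

text \<open>The Riesz representation theorem, by minimising the functional
  \<open>x \<mapsto> \<parallel>x\<parallel>\<^sup>2 - 2 \<phi>(x)\<close>.\<close>

lemma riesz_representation:
  fixes \<phi> :: "'a \<Rightarrow> real"
  assumes add: "\<And>x y. x \<in> H \<Longrightarrow> y \<in> H \<Longrightarrow> \<phi> (x + y) = \<phi> x + \<phi> y"
    and scale: "\<And>r x. x \<in> H \<Longrightarrow> \<phi> (r *\<^sub>R x) = r * \<phi> x"
    and bound: "\<And>x. x \<in> H \<Longrightarrow> \<bar>\<phi> x\<bar> \<le> B * norm x"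
  shows "\<exists>z\<in>H. \<forall>x\<in>H. \<phi> x = inner x z"
proof -
  define J where "J x = inner x x - 2 * \<phi> x" for x
  have lb: "- B\<^sup>2 \<le> J x" if "x \<in> H" for x
  proof -
    have "0 \<le> (norm x - B)\<^sup>2" by simp
    then show ?thesis
      using bound[OF that] by (simp add: J_def power2_diff dot_square_norm abs_le_iff mult.commute)
  qed
  define m where "m = Inf (J ` H)"
  have bdd: "bdd_below (J ` H)" using lb by (auto intro!: bdd_belowI2)
  have m_le: "m \<le> J x" if "x \<in> H" for x
    unfolding m_def using bdd that by (intro cInf_lower) auto
  have "\<exists>x\<in>H. J x < m + inverse (real (Suc n))" for n
  proof -
    have "Inf (J ` H) < m + inverse (real (Suc n))"
      by (simp add: m_def)
    then show ?thesis
      using cInf_less_iff[OF _ bdd, of "m + inverse (real (Suc n))"] hs_0 by (auto simp: m_def)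
  qed
  then obtain X where X: "\<And>n. X n \<in> H" "\<And>n. J (X n) < m + inverse (real (Suc n))"
    by metis
  have \<phi>diff: "\<phi> (x - y) = \<phi> x - \<phi> y" if "x \<in> H" "y \<in> H" for x y
    using add[OF that(1) hs_minus[OF that(2)]] scale[OF that(2), of "- 1"] by simp
  \<comment> \<open>The parallelogram identity makes every minimising sequence a Cauchy sequence.\<close>
  have par: "(norm (x - y))\<^sup>2 \<le> 2 * (J x - m) + 2 * (J y - m)" if "x \<in> H" "y \<in> H" for x y
  proof -
    have "J ((1/2) *\<^sub>R (x + y)) = (inner x x + 2 * inner x y + inner y y) / 4 - \<phi> x - \<phi> y"
      using that by (simp add: J_def scale add hs_scaleR scaleR_add_right inner_add_left inner_add_right
          inner_commute field_simps)
    moreover have "m \<le> J ((1/2) *\<^sub>R (x + y))"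
      using that by (intro m_le hs_scaleR hs_add)
    ultimately show ?thesis
      by (simp add: J_def power2_norm_eq_inner inner_diff_left inner_diff_right inner_commute field_simps)
  qed
  have "Cauchy X"
  proof (rule CauchyI)
    fix e :: real assume "0 < e"
    then obtain N where N: "inverse (real (Suc N)) < e\<^sup>2 / 4"
      using reals_Archimedean[of "e\<^sup>2 / 4"] by auto
    have small: "J (X i) < m + e\<^sup>2 / 4" if "N \<le> i" for i
    proof -
      have "J (X i) < m + inverse (real (Suc i))" by (rule X(2))
      also have "\<dots> \<le> m + inverse (real (Suc N))" using that by simp
      also have "\<dots> < m + e\<^sup>2 / 4" using N by simp
      finally show ?thesis .
    qed
    show "\<exists>M. \<forall>m\<ge>M. \<forall>n\<ge>M. norm (X m - X n) < e"
    proof (intro exI allI impI)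
      fix k n assume "N \<le> k" "N \<le> n"
      then have "J (X k) < m + e\<^sup>2 / 4" "J (X n) < m + e\<^sup>2 / 4"
        using small by blast+
      then have "(norm (X k - X n))\<^sup>2 < e\<^sup>2"
        using par[OF X(1) X(1), of k n] by argo
      then show "norm (X k - X n) < e"
        using \<open>0 < e\<close> power_less_imp_less_base by fastforce
    qed
  qed
  then obtain z where z: "X \<longlonglongrightarrow> z" using Cauchy_convergent convergent_def by blast
  have zH: "z \<in> H" using hs_lim X(1) z by blast
  have "(\<lambda>n. \<phi> (X n)) \<longlonglongrightarrow> \<phi> z"
  proof (rule LIM_zero_cancel, rule Lim_null_comparison)
    show "\<forall>\<^sub>F n in sequentially. norm (\<phi> (X n) - \<phi> z) \<le> B * norm (X n - z)"
      using bound hs_diff X(1) zH by (simp add: \<phi>diff[symmetric])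
    show "(\<lambda>n. B * norm (X n - z)) \<longlonglongrightarrow> 0"
      by (rule tendsto_mult_right_zero, rule tendsto_norm_zero, rule LIM_zero[OF z])
  qed
  then have "(\<lambda>n. J (X n)) \<longlonglongrightarrow> J z"
    unfolding J_def by (intro tendsto_intros z)
  moreover have "(\<lambda>n. m + inverse (real (Suc n))) \<longlonglongrightarrow> m + 0"
    by (intro tendsto_intros LIMSEQ_inverse_real_of_nat)
  ultimately have Jz: "J z \<le> m"
    using X(2) by (intro LIMSEQ_le[of "\<lambda>n. J (X n)" "J z" "\<lambda>n. m + inverse (real (Suc n))" m])
      (auto intro!: less_imp_le)
  have "\<phi> x = inner x z" if xH: "x \<in> H" for x
  proof -
    define d where "d = inner x z - \<phi> x"
    \<comment> \<open>The minimum at \<open>z\<close> is also one along the line through \<open>z\<close> in direction \<open>x\<close>.\<close>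
    have q: "0 \<le> 2 * t * d + t\<^sup>2 * inner x x" for t
    proof -
      have "m \<le> J (z + t *\<^sub>R x)" using zH xH by (intro m_le hs_add hs_scaleR)
      also have "J (z + t *\<^sub>R x) = J z + 2 * t * d + t\<^sup>2 * inner x x"
        using zH xH
        by (simp add: J_def add scale hs_scaleR inner_add_left inner_add_right d_def
            inner_commute power2_eq_square algebra_simps)
      finally show ?thesis using Jz by linarith
    qed
    have "d = 0"
    proof (rule ccontr)
      assume "d \<noteq> 0"
      \<comment> \<open>Adding 1 keeps the denominator of the step \<open>- d / s\<close> positive also for \<open>x = 0\<close>.\<close>
      define s where "s = inner x x + 1"
      have s: "0 < s" by (simp add: s_def add_nonneg_pos)
      have "0 \<le> s\<^sup>2 * (2 * (- d / s) * d + (- d / s)\<^sup>2 * inner x x)"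
        using q[of "- d / s"] by (intro mult_nonneg_nonneg) auto
      also have "\<dots> = d\<^sup>2 * (inner x x - 2 * s)"
        using s by (simp add: field_simps power2_eq_square)
      also have "\<dots> < 0"
        using inner_ge_zero[of x] \<open>d \<noteq> 0\<close> by (intro mult_pos_neg) (auto simp: s_def simp del: inner_ge_zero)
      finally show False by simp
    qed
    then show ?thesis by (simp add: d_def)
  qed
  then show ?thesis using zH by blast
qed

end

lemma bounded_opI:
  assumes "\<And>x. x \<in> H \<Longrightarrow> T x \<in> K"
    and "\<And>x y. x \<in> H \<Longrightarrow> y \<in> H \<Longrightarrow> T (x + y) = T x + T y"
    and "\<And>c x. x \<in> H \<Longrightarrow> T (c *\<^sub>C x) = c *\<^sub>C T x"
    and "\<And>x. x \<in> H \<Longrightarrow> norm (T x) \<le> B * norm x"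
  shows "bounded_op H K T"
  using assms unfolding bounded_op_def by blast

lemma op_mem: "bounded_op H K T \<Longrightarrow> x \<in> H \<Longrightarrow> T x \<in> K"
  and op_add: "bounded_op H K T \<Longrightarrow> x \<in> H \<Longrightarrow> y \<in> H \<Longrightarrow> T (x + y) = T x + T y"
  and op_scaleC: "bounded_op H K T \<Longrightarrow> x \<in> H \<Longrightarrow> T (c *\<^sub>C x) = c *\<^sub>C T x"
  by (auto simp: bounded_op_def)

lemma op_scaleR: "bounded_op H K T \<Longrightarrow> x \<in> H \<Longrightarrow> T (r *\<^sub>R x) = r *\<^sub>R T x"
  by (metis op_scaleC scaleC_of_real)

lemma op_0: "bounded_op H K T \<Longrightarrow> 0 \<in> H \<Longrightarrow> T 0 = 0"
  using op_scaleR[of H K T 0 0] by simp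

lemma op_diff:
  assumes "hilbert_subspace H" "bounded_op H K T" "x \<in> H" "y \<in> H"
  shows "T (x - y) = T x - T y"
  using op_add[OF assms(2,3) hs_minus[OF assms(1,4)]] op_scaleR[OF assms(2,4), of "- 1"] by simp

lemma op_bound:
  assumes "bounded_op H K T"
  obtains B where "0 \<le> B" "\<And>x. x \<in> H \<Longrightarrow> norm (T x) \<le> B * norm x"
proof -
  obtain B where "\<forall>x\<in>H. norm (T x) \<le> B * norm x" using assms unfolding bounded_op_def by blast
  then have "norm (T x) \<le> \<bar>B\<bar> * norm x" if "x \<in> H" for x
    using that by (meson abs_ge_self mult_right_mono norm_ge_zero order_trans)
  then show ?thesis using that[of "\<bar>B\<bar>"] by simp
qed

lemma bounded_op_comp:
  assumes "bounded_op H K T" "bounded_op K L S"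
  shows "bounded_op H L (S \<circ> T)"
proof -
  obtain B where B: "0 \<le> B" "\<And>x. x \<in> H \<Longrightarrow> norm (T x) \<le> B * norm x" using op_bound[OF assms(1)] by blast
  obtain C where C: "0 \<le> C" "\<And>x. x \<in> K \<Longrightarrow> norm (S x) \<le> C * norm x" using op_bound[OF assms(2)] by blast
  show ?thesis
  proof (rule bounded_opI[of _ _ _ "C * B"])
    fix x assume x: "x \<in> H"
    show "norm ((S \<circ> T) x) \<le> C * B * norm x"
      using C(2)[OF op_mem[OF assms(1) x]] mult_left_mono[OF B(2)[OF x] C(1)] by simp
  qed (use assms in \<open>auto simp: op_mem op_add op_scaleC\<close>)
qed

lemma bounded_op_add:
  assumes "hilbert_subspace K" "bounded_op H K T" "bounded_op H K S"
  shows "bounded_op H K (\<lambda>x. T x + S x)"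
proof -
  obtain B where B: "0 \<le> B" "\<And>x. x \<in> H \<Longrightarrow> norm (T x) \<le> B * norm x" using op_bound[OF assms(2)] by blast
  obtain C where C: "0 \<le> C" "\<And>x. x \<in> H \<Longrightarrow> norm (S x) \<le> C * norm x" using op_bound[OF assms(3)] by blast
  show ?thesis
  proof (rule bounded_opI[of _ _ _ "B + C"])
    fix x assume x: "x \<in> H"
    show "norm (T x + S x) \<le> (B + C) * norm x"
      using norm_triangle_ineq[of "T x" "S x"] B(2)[OF x] C(2)[OF x] by (simp add: distrib_right)
  qed (use assms in \<open>auto simp: op_mem op_add op_scaleC hs_add scaleC_add_right\<close>)
qed

lemma bounded_op_scaleR:
  assumes "hilbert_subspace K" "bounded_op H K T"
  shows "bounded_op H K (\<lambda>x. r *\<^sub>R T x)"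
proof -
  obtain B where B: "0 \<le> B" "\<And>x. x \<in> H \<Longrightarrow> norm (T x) \<le> B * norm x" using op_bound[OF assms(2)] by blast
  show ?thesis
  proof (rule bounded_opI[of _ _ _ "\<bar>r\<bar> * B"])
    fix x assume x: "x \<in> H"
    show "norm (r *\<^sub>R T x) \<le> \<bar>r\<bar> * B * norm x"
      using mult_left_mono[OF B(2)[OF x] abs_ge_zero[of r]] by simp
  qed (use assms in \<open>auto simp: op_mem op_add op_scaleC hs_scaleR scaleR_add_right scaleC_scaleR\<close>)
qed

lemma bounded_op_diff:
  assumes "hilbert_subspace K" "bounded_op H K T" "bounded_op H K S"
  shows "bounded_op H K (\<lambda>x. T x - S x)"
  using bounded_op_add[OF assms(1,2) bounded_op_scaleR[OF assms(1,3), of "- 1"]] by simp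

lemma bounded_op_id: "bounded_op H H (\<lambda>x. x)"
  by (rule bounded_opI[of _ _ _ 1]) auto

lemma op_tendsto:
  assumes H: "hilbert_subspace H" and T: "bounded_op H K T"
    and "\<And>n. X n \<in> H" "x \<in> H" "X \<longlonglongrightarrow> x"
  shows "(\<lambda>n. T (X n)) \<longlonglongrightarrow> T x"
proof -
  obtain B where B: "0 \<le> B" "\<And>x. x \<in> H \<Longrightarrow> norm (T x) \<le> B * norm x" using op_bound[OF T] by blast
  show ?thesis
  proof (rule LIM_zero_cancel, rule Lim_null_comparison)
    show "\<forall>\<^sub>F n in sequentially. norm (T (X n) - T x) \<le> B * norm (X n - x)"
      using B(2) hs_diff[OF H] assms by (simp add: op_diff[OF H T, symmetric])
    show "(\<lambda>n. B * norm (X n - x)) \<longlonglongrightarrow> 0"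
      by (rule tendsto_mult_right_zero, rule tendsto_norm_zero, rule LIM_zero[OF assms(5)])
  qed
qed

lemma op_norm_bdd:
  assumes "bounded_op H K T"
  shows "bdd_above {norm (T x) | x. x \<in> H \<and> norm x \<le> 1}"
proof -
  obtain B where B: "0 \<le> B" "\<And>x. x \<in> H \<Longrightarrow> norm (T x) \<le> B * norm x" using op_bound[OF assms] by blast
  show ?thesis
  proof (rule bdd_aboveI[of _ B])
    fix y assume "y \<in> {norm (T x) | x. x \<in> H \<and> norm x \<le> 1}"
    then obtain x where x: "y = norm (T x)" "x \<in> H" "norm x \<le> 1" by blast
    then show "y \<le> B" using B(2)[OF x(2)] mult_left_mono[OF x(3) B(1)] by simp
  qed
qed

lemma op_norm_nonneg:
  assumes "hilbert_subspace H" "bounded_op H K T"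
  shows "0 \<le> op_norm H T"
proof -
  have "norm (T 0) \<le> op_norm H T"
    unfolding op_norm_def using hs_0[OF assms(1)]
    by (intro cSup_upper op_norm_bdd[OF assms(2)]) force
  then show ?thesis by (meson norm_ge_zero order_trans)
qed

lemma op_norm_bound:
  assumes H: "hilbert_subspace H" and T: "bounded_op H K T" and x: "x \<in> H"
  shows "norm (T x) \<le> op_norm H T * norm x"
proof (cases "x = 0")
  case True
  then show ?thesis using op_0[OF T hs_0[OF H]] by simp
next
  case False
  have "norm (T (inverse (norm x) *\<^sub>R x)) \<le> op_norm H T"
    unfolding op_norm_def using False hs_scaleR[OF H x]
    by (intro cSup_upper op_norm_bdd[OF T]) force
  then show ?thesis using False by (simp add: op_scaleR[OF T x] field_simps)
qed

lemma op_norm_le: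
  assumes H: "hilbert_subspace H" and "\<And>x. x \<in> H \<Longrightarrow> norm (T x) \<le> B * norm x" and "0 \<le> B"
  shows "op_norm H T \<le> B"
  unfolding op_norm_def
proof (rule cSup_least)
  show "{norm (T x) |x. x \<in> H \<and> norm x \<le> 1} \<noteq> {}" using hs_0[OF H] by force
  fix y assume "y \<in> {norm (T x) | x. x \<in> H \<and> norm x \<le> 1}"
  then obtain x where x: "y = norm (T x)" "x \<in> H" "norm x \<le> 1" by blast
  then show "y \<le> B" using assms(2)[OF x(2)] mult_left_mono[OF x(3) assms(3)] by simp
qed

section \<open>Adjoints\<close>

lemma eq_if_inner_eq:
  assumes "hilbert_subspace H" "v \<in> H" "w \<in> H" "\<And>z. z \<in> H \<Longrightarrow> inner z v = inner z w"
  shows "v = w"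
proof -
  have "inner (v - w) v = inner (v - w) w" using assms hs_diff by blast
  then have "inner (v - w) (v - w) = 0" by (simp add: inner_diff_right)
  then show "v = w" by simp
qed

lemma op_adjoint_exists:
  assumes H: "hilbert_subspace H" and X: "bounded_op H K X"
  shows "\<exists>w\<in>H. \<forall>z\<in>H. cinner (X z) y = cinner z w"
proof -
  obtain B where B: "0 \<le> B" "\<And>x. x \<in> H \<Longrightarrow> norm (X x) \<le> B * norm x" using op_bound[OF X] by blast
  have "\<exists>w\<in>H. \<forall>z\<in>H. inner (X z) y = inner z w"
  proof (rule riesz_representation[OF H, of _ "B * norm y"])
    fix x assume x: "x \<in> H"
    have "\<bar>inner (X x) y\<bar> \<le> norm (X x) * norm y" by (rule Cauchy_Schwarz_ineq2)
    also have "\<dots> \<le> B * norm x * norm y" by (rule mult_right_mono[OF B(2)[OF x]]) simp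
    finally show "\<bar>inner (X x) y\<bar> \<le> B * norm y * norm x" by (simp add: mult_ac)
  qed (simp_all add: op_add[OF X] op_scaleR[OF X] inner_add_left)
  then obtain w where w: "w \<in> H" "\<And>z. z \<in> H \<Longrightarrow> inner (X z) y = inner z w" by blast
  have "cinner (X z) y = cinner z w" if z: "z \<in> H" for z
    using w(2)[OF z] w(2)[OF hs_scaleC[OF H z], of \<i>]
    by (simp add: op_scaleC[OF X z] inner_ii_left cinner_conv_inner)
  then show ?thesis using w(1) by blast
qed

lemma op_adjoint_spec:
  assumes H: "hilbert_subspace H" and X: "bounded_op H K X"
  shows op_adjoint_mem: "op_adjoint H X y \<in> H"
    and cinner_op_adjoint: "\<And>z. z \<in> H \<Longrightarrow> cinner (X z) y = cinner z (op_adjoint H X y)"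
proof -
  let ?P = "\<lambda>x. x \<in> H \<and> (\<forall>z\<in>H. cinner (X z) y = cinner z x)"
  have "\<exists>!x. ?P x"
  proof (rule ex_ex1I)
    show "\<exists>x. ?P x" using op_adjoint_exists[OF assms] by blast
    fix v w assume v: "?P v" and w: "?P w"
    then show "v = w" by (intro eq_if_inner_eq[OF H]) (auto simp flip: Re_cinner)
  qed
  from theI'[OF this] have "?P (op_adjoint H X y)" unfolding op_adjoint_def .
  then show "op_adjoint H X y \<in> H" "\<And>z. z \<in> H \<Longrightarrow> cinner (X z) y = cinner z (op_adjoint H X y)"
    by blast+
qed

lemma inner_op_adjoint:
  assumes "hilbert_subspace H" "bounded_op H K X" "z \<in> H"
  shows "inner (X z) y = inner z (op_adjoint H X y)"
  by (metis Re_cinner cinner_op_adjoint[OF assms])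

lemma bounded_op_adjoint:
  assumes H: "hilbert_subspace H" and X: "bounded_op H K X"
  shows "bounded_op K H (op_adjoint H X)"
proof -
  obtain B where B: "0 \<le> B" "\<And>x. x \<in> H \<Longrightarrow> norm (X x) \<le> B * norm x" using op_bound[OF X] by blast
  note mem = op_adjoint_mem[OF H X] and adj = inner_op_adjoint[OF H X]
  show ?thesis
  proof (rule bounded_opI[of _ _ _ B])
    fix y
    let ?w = "op_adjoint H X y"
    have "norm ?w * norm ?w = inner (X ?w) y"
      using adj[OF mem] by (simp add: dot_square_norm power2_eq_square)
    also have "\<dots> \<le> norm (X ?w) * norm y" by (rule norm_cauchy_schwarz)
    also have "\<dots> \<le> B * norm ?w * norm y" by (rule mult_right_mono[OF B(2)[OF mem]]) simp
    finally have "norm ?w * norm ?w \<le> norm ?w * (B * norm y)" by (simp add: mult_ac)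
    then show "norm ?w \<le> B * norm y"
      using B(1) by (cases "norm ?w = 0") auto
  next
    fix x y
    show "op_adjoint H X (x + y) = op_adjoint H X x + op_adjoint H X y"
      by (rule eq_if_inner_eq[OF H])
        (simp_all add: mem hs_add[OF H] adj[symmetric] inner_add_right)
  next
    fix c x
    show "op_adjoint H X (c *\<^sub>C x) = c *\<^sub>C op_adjoint H X x"
    proof (rule eq_if_inner_eq[OF H])
      fix z assume z: "z \<in> H"
      have "cinner z (op_adjoint H X (c *\<^sub>C x)) = cinner z (c *\<^sub>C op_adjoint H X x)"
        using z by (simp add: cinner_op_adjoint[OF H X, symmetric] cinner_scaleC_right)
      then show "inner z (op_adjoint H X (c *\<^sub>C x)) = inner z (c *\<^sub>C op_adjoint H X x)"
        by (metis Re_cinner)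
    qed (simp_all add: mem hs_scaleC[OF H])
  qed (rule mem)
qed

lemma op_adjoint_adjoint:
  assumes H: "hilbert_subspace H" and X: "bounded_op H H X" and x: "x \<in> H"
  shows "op_adjoint H (op_adjoint H X) x = X x"
proof (rule eq_if_inner_eq[OF H])
  note X' = bounded_op_adjoint[OF H X]
  show "op_adjoint H (op_adjoint H X) x \<in> H" by (rule op_adjoint_mem[OF H X'])
  show "X x \<in> H" by (rule op_mem[OF X x])
  show "inner z (op_adjoint H (op_adjoint H X) x) = inner z (X x)" if "z \<in> H" for z
    using inner_op_adjoint[OF H X' that, of x] inner_op_adjoint[OF H X x, of z]
    by (simp add: inner_commute)
qed

section \<open>Coercive operators and the spectrum of a positive operator\<close>

text \<open>For a small step size \<open>s\<close> the map \<open>x \<mapsto> x - s (S x - y)\<close> is a contraction of the space.\<close>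

lemma coercive_surj:
  assumes H: "hilbert_subspace H" and S: "bounded_op H H S" and c: "0 < c"
    and coer: "\<And>x. x \<in> H \<Longrightarrow> c * (norm x)\<^sup>2 \<le> inner (S x) x" and y: "y \<in> H"
  shows "\<exists>x\<in>H. S x = y"
proof -
  obtain B0 where B0: "0 \<le> B0" "\<And>x. x \<in> H \<Longrightarrow> norm (S x) \<le> B0 * norm x" using op_bound[OF S] by blast
  define B where "B = B0 + c"
  have B: "c \<le> B" "0 < B" "norm (S x) \<le> B * norm x" if "x \<in> H" for x
    using B0(1) B0(2)[OF that] c by (auto simp: B_def distrib_right intro: add_increasing2)
  have B': "c \<le> B" "0 < B" using B0(1) c by (auto simp: B_def)
  define s where "s = c / B\<^sup>2"
  have s: "0 < s" using B' c by (simp add: s_def)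
  have "c\<^sup>2 \<le> B\<^sup>2" using B' c by (intro power_mono) auto
  then have r: "s * c \<le> 1" "0 < s * c" "s\<^sup>2 * B\<^sup>2 = s * c"
    using B' c by (simp_all add: s_def power2_eq_square)
  define q where "q = sqrt (1 - s * c)"
  have q: "0 \<le> q" "q < 1" "q\<^sup>2 = 1 - s * c"
    using r(1,2) by (simp_all add: q_def)
  define F where "F x = x - s *\<^sub>R (S x - y)" for x
  have contr: "norm (x - s *\<^sub>R S x) \<le> q * norm x" if x: "x \<in> H" for x
  proof -
    have "(norm (x - s *\<^sub>R S x))\<^sup>2 = (norm x)\<^sup>2 - 2 * s * inner (S x) x + s\<^sup>2 * (norm (S x))\<^sup>2"
      unfolding power2_norm_eq_inner
      by (simp add: inner_diff_left inner_diff_right inner_commute power2_eq_square algebra_simps)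
    also have "\<dots> \<le> (norm x)\<^sup>2 - 2 * s * (c * (norm x)\<^sup>2) + s\<^sup>2 * (B * norm x)\<^sup>2"
      using coer[OF x] s B(3)[OF x] by (intro add_mono diff_mono mult_left_mono power_mono) auto
    also have "\<dots> = (norm x)\<^sup>2 - 2 * (s * c) * (norm x)\<^sup>2 + (s\<^sup>2 * B\<^sup>2) * (norm x)\<^sup>2"
      by (simp add: power_mult_distrib)
    also have "\<dots> = q\<^sup>2 * (norm x)\<^sup>2"
      unfolding r(3) q(3) by (simp add: algebra_simps)
    finally have "(norm (x - s *\<^sub>R S x))\<^sup>2 \<le> (q * norm x)\<^sup>2" by (simp add: power_mult_distrib)
    then show ?thesis using q(1) by (meson power2_le_imp_le mult_nonneg_nonneg norm_ge_zero)
  qed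
  have "\<exists>!x\<in>H. F x = x"
  proof (rule Banach_fix[of H q])
    show "complete H" using hs_closed[OF H] complete_eq_closed by blast
    show "H \<noteq> {}" using hs_0[OF H] by blast
    show "F ` H \<subseteq> H" using y by (auto simp: F_def intro!: hs_diff[OF H] hs_scaleR[OF H] op_mem[OF S])
    fix x z assume x: "x \<in> H" and z: "z \<in> H"
    have "F x - F z = (x - z) - s *\<^sub>R S (x - z)"
      by (simp add: F_def op_diff[OF H S x z] algebra_simps)
    then show "dist (F x) (F z) \<le> q * dist x z"
      using contr[OF hs_diff[OF H x z]] by (simp add: dist_norm)
  qed (use q in auto)
  then show ?thesis using s by (auto simp: F_def)
qed

text \<open>The sign of \<open>e\<close> allows \<open>T - t\<close> to be coercive or the negative of a coercive operator.\<close>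

lemma not_in_spectrum:
  assumes H: "hilbert_subspace H" and T: "bounded_op H H T" and c: "0 < c"
    and coer: "\<And>x. x \<in> H \<Longrightarrow> c * (norm x)\<^sup>2 \<le> e * inner (T x - t *\<^sub>R x) x"
  shows "complex_of_real t \<notin> op_spectrum H T"
proof -
  define D where "D x = T x - t *\<^sub>R x" for x
  have D: "bounded_op H H D"
    unfolding D_def by (intro bounded_op_diff bounded_op_scaleR H T bounded_op_id)
  have below: "c * norm x \<le> \<bar>e\<bar> * norm (D x)" if x: "x \<in> H" for x
  proof -
    have "c * norm x * norm x \<le> e * inner (D x) x"
      using coer[OF x] by (simp add: D_def power2_eq_square mult_ac)
    also have "\<dots> \<le> \<bar>e\<bar> * \<bar>inner (D x) x\<bar>" by (metis abs_ge_self abs_mult)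
    also have "\<dots> \<le> \<bar>e\<bar> * (norm (D x) * norm x)"
      by (intro mult_left_mono Cauchy_Schwarz_ineq2) auto
    finally have "c * norm x * norm x \<le> (\<bar>e\<bar> * norm (D x)) * norm x" by (simp only: mult.assoc)
    then show ?thesis by (cases "norm x = 0") (simp_all only: mult_le_cancel_right, simp_all)
  qed
  have inj: "x = z" if "x \<in> H" "z \<in> H" "D x = D z" for x z
  proof -
    have "c * norm (x - z) \<le> 0"
      using below[OF hs_diff[OF H that(1,2)]] that by (simp add: op_diff[OF H D])
    then show ?thesis using c by (simp add: mult_le_0_iff)
  qed
  have "\<exists>x\<in>H. D x = y" if y: "y \<in> H" for y
  proof -
    have "\<exists>x\<in>H. e *\<^sub>R D x = e *\<^sub>R y"
      by (rule coercive_surj[OF H bounded_op_scaleR[OF H D] c _ hs_scaleR[OF H y]])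
        (use coer in \<open>simp add: D_def\<close>)
    moreover have "y = 0" if "e = 0"
      using below[OF y] c that by (simp add: mult_le_0_iff)
    ultimately show ?thesis using op_0[OF D hs_0[OF H]] hs_0[OF H] by (cases "e = 0") auto
  qed
  then obtain V where V: "\<And>y. y \<in> H \<Longrightarrow> V y \<in> H" "\<And>y. y \<in> H \<Longrightarrow> D (V y) = y"
    by metis
  have VD: "V (D x) = x" if "x \<in> H" for x
    by (rule inj[OF V(1)[OF op_mem[OF D that]] that V(2)[OF op_mem[OF D that]]])
  have "bounded_op H H V"
  proof (rule bounded_opI[of _ _ _ "\<bar>e\<bar> / c"])
    fix x y assume "x \<in> H" "y \<in> H"
    then show "V (x + y) = V x + V y"
      by - (rule inj, auto simp: V hs_add[OF H] op_add[OF D])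
  next
    fix a x assume "x \<in> H"
    then show "V (a *\<^sub>C x) = a *\<^sub>C V x"
      by - (rule inj, auto simp: V hs_scaleC[OF H] op_scaleC[OF D])
  next
    fix x assume "x \<in> H"
    then show "norm (V x) \<le> \<bar>e\<bar> / c * norm x"
      using below[OF V(1)[OF \<open>x \<in> H\<close>]] V(2)[OF \<open>x \<in> H\<close>] c by (simp add: field_simps)
  qed (rule V)
  moreover have "V (T x - complex_of_real t *\<^sub>C x) = x"
    "T (V x) - complex_of_real t *\<^sub>C V x = x" if "x \<in> H" for x
    using VD[OF that] V(2)[OF that] by (simp_all add: D_def scaleC_of_real)
  ultimately show ?thesis unfolding op_spectrum_def by blast
qed

section \<open>Polynomials of symmetric operators\<close>

text \<open>Bounded symmetric operators on \<open>H\<close>. Symmetry for the real inner product is enough, because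
  bounded operators are complex linear.\<close>

definition symmetric_op :: "'a::complex_hilbert set \<Rightarrow> ('a \<Rightarrow> 'a) \<Rightarrow> bool" where
  "symmetric_op H T \<longleftrightarrow> bounded_op H H T \<and> (\<forall>x\<in>H. \<forall>y\<in>H. inner (T x) y = inner x (T y))"

lemma op_poly_eq_sum:
  assumes "degree p \<le> n"
  shows "op_poly p T x = (\<Sum>k\<le>n. coeff p k *\<^sub>R (T ^^ k) x)"
  unfolding op_poly_def using assms
  by (intro sum.mono_neutral_left) (auto intro!: coeff_eq_0)

lemma op_poly_0 [simp]: "op_poly 0 T x = 0"
  by (simp add: op_poly_def)

lemma op_poly_add: "op_poly (p + q) T x = op_poly p T x + op_poly q T x"
proof -
  let ?n = "max (degree p) (degree q)"
  have "degree (p + q) \<le> ?n" "degree p \<le> ?n" "degree q \<le> ?n"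
    by (auto intro: degree_add_le)
  from this[THEN op_poly_eq_sum[where T = T and x = x]] show ?thesis
    by (simp add: scaleR_left_distrib sum.distrib)
qed

lemma op_poly_smult: "op_poly (smult a p) T x = a *\<^sub>R op_poly p T x"
  by (simp add: op_poly_eq_sum[OF degree_smult_le] op_poly_def scaleR_right.sum)

lemma op_poly_diff: "op_poly (p - q) T x = op_poly p T x - op_poly q T x"
  using op_poly_add[of p "smult (- 1) q" T x] unfolding op_poly_smult by simp

lemma op_poly_pCons: "op_poly (pCons a p) T x = a *\<^sub>R x + op_poly p T (T x)"
proof -
  have "op_poly (pCons a p) T x = (\<Sum>k\<le>Suc (degree p). coeff (pCons a p) k *\<^sub>R (T ^^ k) x)"
    by (rule op_poly_eq_sum) (rule degree_pCons_le)
  also have "\<dots> = a *\<^sub>R x + (\<Sum>k\<le>degree p. coeff p k *\<^sub>R (T ^^ k) (T x))"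
    by (simp add: sum.atMost_Suc_shift funpow_swap1 del: sum.atMost_Suc)
  finally show ?thesis by (simp add: op_poly_def)
qed

lemma bounded_op_poly:
  assumes H: "hilbert_subspace H" and T: "bounded_op H H T"
  shows "bounded_op H H (op_poly p T)"
proof (induction p)
  case 0
  show ?case by (rule bounded_opI[of _ _ _ 0]) (auto simp: hs_0[OF H])
next
  case (pCons a p)
  have "op_poly (pCons a p) T = (\<lambda>x. a *\<^sub>R x + (op_poly p T \<circ> T) x)"
    by (simp add: fun_eq_iff op_poly_pCons)
  then show ?case
    using bounded_op_add[OF H bounded_op_scaleR[OF H bounded_op_id] bounded_op_comp[OF T pCons.IH]]
    by simp
qed

lemma op_poly_commute:
  assumes H: "hilbert_subspace H" and T: "bounded_op H H T" and "x \<in> H"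
  shows "op_poly p T (T x) = T (op_poly p T x)"
  using assms(3)
proof (induction p arbitrary: x)
  case 0
  then show ?case by (simp add: op_0[OF T hs_0[OF H]])
next
  case (pCons a p)
  then show ?case
    using op_mem[OF T] op_mem[OF bounded_op_poly[OF H T]]
    by (simp add: op_poly_pCons op_add[OF T] op_scaleR[OF T] hs_scaleR[OF H])
qed

lemma op_poly_mult:
  assumes H: "hilbert_subspace H" and T: "bounded_op H H T" and "x \<in> H"
  shows "op_poly (p * q) T x = op_poly p T (op_poly q T x)"
  using assms(3)
proof (induction p arbitrary: x)
  case (pCons a p)
  then show ?case
    using op_mem[OF T] op_mem[OF bounded_op_poly[OF H T]]
    by (simp add: op_poly_add op_poly_smult op_poly_pCons op_poly_commute[OF H T])
qed simp

lemma symmetric_op_poly: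
  assumes H: "hilbert_subspace H" and T: "symmetric_op H T"
  shows "symmetric_op H (op_poly p T)"
proof -
  have T': "bounded_op H H T" and sym: "\<And>x y. x \<in> H \<Longrightarrow> y \<in> H \<Longrightarrow> inner (T x) y = inner x (T y)"
    using T by (auto simp: symmetric_op_def)
  note P = bounded_op_poly[OF H T']
  have "inner (op_poly p T x) y = inner x (op_poly p T y)" if "x \<in> H" "y \<in> H" for x y
    using that
  proof (induction p arbitrary: x y)
    case (pCons a p)
    then have "inner (op_poly p T (T x)) y = inner x (op_poly p T (T y))"
      using sym op_mem[OF P] op_mem[OF T'] by (simp add: op_poly_commute[OF H T'])
    then show ?case by (simp add: op_poly_pCons inner_add_left inner_add_right)
  qed simp
  then show ?thesis using P by (simp add: symmetric_op_def)
qed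

text \<open>A nonconstant real polynomial has a linear or an irreducible quadratic real factor.\<close>

lemma real_poly_factor:
  fixes q :: "real poly"
  assumes "0 < degree q"
  shows "(\<exists>t. [:- t, 1:] dvd q) \<or> (\<exists>a b. b \<noteq> 0 \<and> [:a\<^sup>2 + b\<^sup>2, - 2 * a, 1:] dvd q)"
proof -
  define ev where "ev p z = poly (map_poly complex_of_real p) z" for p z
  have ev_pCons: "ev (pCons a p) z = complex_of_real a + z * ev p z" for a p z
    by (simp add: ev_def map_poly_pCons)
  have ev_0: "ev 0 z = 0" for z by (simp add: ev_def)
  have ev_add: "ev (p + r) z = ev p z + ev r z" for p r z
  proof -
    have "map_poly complex_of_real (p + r) = map_poly complex_of_real p + map_poly complex_of_real r"
      by (rule poly_eqI) (simp add: coeff_map_poly)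
    then show ?thesis by (simp add: ev_def)
  qed
  have ev_smult: "ev (smult a p) z = complex_of_real a * ev p z" for a p z
    by (simp add: ev_def map_poly_smult)
  have ev_mult: "ev (p * r) z = ev p z * ev r z" for p r z
    by (induction p) (simp_all add: ev_0 ev_add ev_smult ev_pCons algebra_simps)
  have "\<not> constant (poly (map_poly complex_of_real q))"
    using assms by (simp add: constant_degree degree_map_poly)
  then obtain z where z: "ev q z = 0"
    using fundamental_theorem_of_algebra by (auto simp: ev_def)
  have real: "ev p (complex_of_real t) = complex_of_real (poly p t)" for p t
    by (induction p) (simp_all add: ev_0 ev_pCons)
  show ?thesis
  proof (cases "Im z = 0")
    case True
    then have "z = complex_of_real (Re z)" by (simp add: complex_eq_iff)
    then have "poly q (Re z) = 0" using z real[of q "Re z"] by (metis of_real_eq_0_iff)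
    then show ?thesis by (auto simp: poly_eq_0_iff_dvd)
  next
    case False
    define d where "d = [:(Re z)\<^sup>2 + (Im z)\<^sup>2, - 2 * Re z, 1:]"
    have "ev d z = 0"
      by (simp add: d_def ev_pCons ev_0 complex_eq_iff power2_eq_square algebra_simps)
    moreover have "q = d * (q div d) + q mod d" by simp
    ultimately have r: "ev (q mod d) z = 0"
      using z ev_add[of "d * (q div d)" "q mod d" z] ev_mult[of d "q div d" z] by simp
    have "q mod d = 0 \<or> degree (q mod d) < degree d"
      by (rule degree_mod_less) (simp add: d_def)
    then have "degree (q mod d) \<le> 1" by (auto simp: d_def)
    then have r01: "q mod d = [:coeff (q mod d) 0, coeff (q mod d) 1:]"
      by (intro poly_eqI) (auto simp: coeff_pCons coeff_eq_0 split: nat.splits)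
    define r0 r1 where "r0 = coeff (q mod d) 0" and "r1 = coeff (q mod d) 1"
    note r01 = r01[folded r0_def r1_def]
    from r have "r1 = 0" "r0 = 0"
      using False by (auto simp: r01 ev_pCons ev_0 complex_eq_iff)
    then have "d dvd q" using r01 by (simp add: mod_eq_0_iff_dvd)
    then show ?thesis using False by (auto simp: d_def)
  qed
qed

text \<open>If \<open>q\<close> has no root in the real spectrum of \<open>T\<close>, then \<open>q(T)\<close> is bounded below: its linear
  factors because their roots lie outside the spectrum, the quadratic ones by symmetry of \<open>T\<close>.\<close>

lemma op_poly_bounded_below:
  assumes H: "hilbert_subspace H" and T: "symmetric_op H T"
    and "q \<noteq> 0" and "\<And>t. poly q t = 0 \<Longrightarrow> complex_of_real t \<notin> op_spectrum H T"
  shows "\<exists>c>0. \<forall>x\<in>H. c * norm x \<le> norm (op_poly q T x)"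
  using assms(3,4)
proof (induction "degree q" arbitrary: q rule: less_induct)
  case less
  have T': "bounded_op H H T" and sym: "\<And>x y. x \<in> H \<Longrightarrow> y \<in> H \<Longrightarrow> inner (T x) y = inner x (T y)"
    using T by (auto simp: symmetric_op_def)
  note P = bounded_op_poly[OF H T']
  have factor: ?case
    if q: "q = d * r" "0 < degree d" and c: "0 < c" "\<And>x. x \<in> H \<Longrightarrow> c * norm x \<le> norm (op_poly d T x)"
    for d r c
  proof -
    have nz: "d \<noteq> 0" "r \<noteq> 0" using less.prems(1) q(1) by auto
    then have "degree r < degree q" using q by (simp add: degree_mult_eq)
    moreover have "complex_of_real t \<notin> op_spectrum H T" if "poly r t = 0" for t
      using less.prems(2)[of t] that q(1) by simp
    ultimately obtain c' where c': "0 < c'" "\<And>x. x \<in> H \<Longrightarrow> c' * norm x \<le> norm (op_poly r T x)"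
      using less.hyps nz(2) by blast
    have "c * c' * norm x \<le> norm (op_poly q T x)" if x: "x \<in> H" for x
    proof -
      have "c * c' * norm x \<le> c * norm (op_poly r T x)"
        using c'(2)[OF x] c(1) by (simp add: mult.assoc)
      also have "\<dots> \<le> norm (op_poly q T x)"
        using c(2)[OF op_mem[OF P x]] unfolding q(1) op_poly_mult[OF H T' x] .
      finally show ?thesis .
    qed
    then show ?case using c(1) c'(1) by (intro exI[of _ "c * c'"]) simp
  qed
  show ?case
  proof (cases "degree q = 0")
    case True
    then obtain a where a: "q = [:a:]" by (rule degree_eq_zeroE)
    then show ?thesis using less.prems(1)
      by (intro exI[of _ "\<bar>a\<bar>"]) (simp add: op_poly_pCons)
  next
    case False
    then consider t where "[:- t, 1:] dvd q" | a b where "b \<noteq> 0" "[:a\<^sup>2 + b\<^sup>2, - 2 * a, 1:] dvd q"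
      using real_poly_factor by blast
    then show ?thesis
    proof cases
      case (1 t)
      then obtain r where r: "q = [:- t, 1:] * r" by (elim dvdE)
      then have "complex_of_real t \<notin> op_spectrum H T" using less.prems(2)[of t] by simp
      then obtain V where V: "bounded_op H H V" "\<And>x. x \<in> H \<Longrightarrow> V (T x - t *\<^sub>R x) = x"
        by (auto simp: op_spectrum_def scaleC_of_real)
      obtain B where B: "0 \<le> B" "\<And>x. x \<in> H \<Longrightarrow> norm (V x) \<le> B * norm x" using op_bound[OF V(1)] by blast
      have "1 / (B + 1) * norm x \<le> norm (op_poly [:- t, 1:] T x)" if x: "x \<in> H" for x
      proof -
        have mem: "T x - t *\<^sub>R x \<in> H" using x by (intro hs_diff[OF H] hs_scaleR[OF H] op_mem[OF T'])
        have "norm x \<le> B * norm (T x - t *\<^sub>R x)" using B(2)[OF mem] V(2)[OF x] by simp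
        also have "\<dots> \<le> (B + 1) * norm (T x - t *\<^sub>R x)" by (simp add: distrib_right)
        finally show ?thesis using B(1) by (simp add: op_poly_pCons field_simps)
      qed
      then show ?thesis using B(1) by (intro factor[OF r, of "1 / (B + 1)"]) simp_all
    next
      case (2 a b)
      define d where "d = [:a\<^sup>2 + b\<^sup>2, - 2 * a, 1:]"
      obtain r where r: "q = d * r" using 2(2) by (auto simp: d_def elim: dvdE)
      have "b\<^sup>2 * norm x \<le> norm (op_poly d T x)" if x: "x \<in> H" for x
      proof -
        have Tx: "T x \<in> H" by (rule op_mem[OF T' x])
        have "inner (op_poly d T x) x = inner (T x - a *\<^sub>R x) (T x - a *\<^sub>R x) + b\<^sup>2 * inner x x"
          using sym[OF Tx x] by (simp add: d_def op_poly_pCons inner_diff_left inner_diff_right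
              inner_add_left inner_add_right inner_commute power2_eq_square algebra_simps)
        then have "b\<^sup>2 * inner x x \<le> inner (op_poly d T x) x" by simp
        also have "\<dots> \<le> norm (op_poly d T x) * norm x" by (rule norm_cauchy_schwarz)
        finally have "b\<^sup>2 * norm x * norm x \<le> norm (op_poly d T x) * norm x"
          by (simp add: dot_square_norm power2_eq_square mult.assoc)
        then show ?thesis by (cases "x = 0") simp_all
      qed
      then show ?thesis using 2(1) by (intro factor[OF r, of "b\<^sup>2"]) (simp_all add: d_def)
    qed
  qed
qed

text \<open>Unless \<open>r\<^sup>2\<close> is the constant \<open>\<parallel>r(T)\<parallel>\<^sup>2\<close>, the norm of \<open>r(T)\<close> is attained by \<open>\<bar>r\<bar>\<close> on the real
  spectrum, because \<open>r(T)\<^sup>2 - \<parallel>r(T)\<parallel>\<^sup>2\<close> is not bounded below.\<close>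

lemma op_poly_norm_attained:
  assumes H: "hilbert_subspace H" and T: "symmetric_op H T" and "x0 \<in> H" "x0 \<noteq> 0"
    and nz: "r * r \<noteq> [:(op_norm H (op_poly r T))\<^sup>2:]"
  shows "\<exists>t. complex_of_real t \<in> op_spectrum H T \<and> \<bar>poly r t\<bar> = op_norm H (op_poly r T)"
proof (rule ccontr)
  assume no: "\<not> ?thesis"
  define S where "S = op_poly r T"
  define N where "N = op_norm H S"
  have T': "bounded_op H H T" using T by (simp add: symmetric_op_def)
  have S: "bounded_op H H S" and sym: "\<And>x y. x \<in> H \<Longrightarrow> y \<in> H \<Longrightarrow> inner (S x) y = inner x (S y)"
    using symmetric_op_poly[OF H T, of r] by (auto simp: symmetric_op_def S_def)
  have N0: "0 \<le> N" unfolding N_def by (rule op_norm_nonneg[OF H S])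
  note bound = op_norm_bound[OF H S, folded N_def]
  let ?q = "r * r - [:N\<^sup>2:]"
  have "complex_of_real t \<notin> op_spectrum H T" if "poly ?q t = 0" for t
  proof -
    have "(poly r t)\<^sup>2 = N\<^sup>2" using that by (simp add: power2_eq_square)
    then have "\<bar>poly r t\<bar> = N" using N0 by (metis abs_of_nonneg power2_eq_iff abs_minus_cancel)
    then show ?thesis using no by (auto simp: N_def S_def)
  qed
  moreover have "?q \<noteq> 0" using nz by (simp add: N_def S_def)
  ultimately obtain c where c: "0 < c" "\<And>x. x \<in> H \<Longrightarrow> c * norm x \<le> norm (op_poly ?q T x)"
    using op_poly_bounded_below[OF H T, of ?q] by blast
  have key: "(c * norm x)\<^sup>2 \<le> N\<^sup>2 * (N\<^sup>2 * (norm x)\<^sup>2 - (norm (S x))\<^sup>2)" if x: "x \<in> H" for x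
  proof -
    have Sx: "S x \<in> H" by (rule op_mem[OF S x])
    have q: "op_poly ?q T x = S (S x) - N\<^sup>2 *\<^sub>R x"
      by (simp add: op_poly_diff op_poly_mult[OF H T' x] op_poly_pCons S_def)
    have "(c * norm x)\<^sup>2 \<le> (norm (op_poly ?q T x))\<^sup>2"
      using c(1) c(2)[OF x] by (intro power_mono) auto
    also have "\<dots> = (norm (S (S x)))\<^sup>2 - 2 * N\<^sup>2 * inner (S (S x)) x + N\<^sup>2 * N\<^sup>2 * (norm x)\<^sup>2"
      unfolding q power2_norm_eq_inner
      by (simp add: inner_diff_left inner_diff_right inner_commute algebra_simps)
    also have "inner (S (S x)) x = (norm (S x))\<^sup>2"
      unfolding sym[OF Sx x] by (simp add: dot_square_norm)
    also have "(norm (S (S x)))\<^sup>2 \<le> (N * norm (S x))\<^sup>2"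
      by (intro power_mono bound Sx) simp
    finally show ?thesis by (simp add: power_mult_distrib algebra_simps)
  qed
  show False
  proof (cases "N = 0")
    case True
    then show False using key[OF assms(3)] c(1) assms(4) by simp
  next
    case False
    then have N: "0 < N" using N0 by simp
    define k where "k = N\<^sup>2 - c\<^sup>2 / N\<^sup>2"
    have le: "(norm (S x))\<^sup>2 \<le> k * (norm x)\<^sup>2" if "x \<in> H" for x
      using key[OF that] N by (simp add: k_def power_mult_distrib field_simps)
    have "0 \<le> k * (norm x0)\<^sup>2" using le[OF assms(3)] by (meson order_trans zero_le_power2)
    then have k: "0 \<le> k" using assms(4) by (simp add: zero_le_mult_iff)
    have "N \<le> sqrt k"
      unfolding N_def
    proof (rule op_norm_le[OF H])
      fix x assume "x \<in> H"
      from real_sqrt_le_mono[OF le[OF this]]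
      show "norm (S x) \<le> sqrt k * norm x" by (simp add: real_sqrt_mult)
    qed (simp add: k)
    then have "N\<^sup>2 \<le> k" using N0 k by (metis power_mono real_sqrt_pow2)
    moreover have "0 < c\<^sup>2 / N\<^sup>2" using c(1) N by simp
    ultimately show False by (simp add: k_def)
  qed
qed

lemma op_poly_norm_le:
  assumes H: "hilbert_subspace H" and T: "symmetric_op H T"
    and B: "0 \<le> B" "\<And>t. complex_of_real t \<in> op_spectrum H T \<Longrightarrow> \<bar>poly r t\<bar> \<le> B" and x: "x \<in> H"
  shows "norm (op_poly r T x) \<le> B * norm x"
proof (cases "x = 0")
  case True
  have "bounded_op H H T" using T by (simp add: symmetric_op_def)
  from op_0[OF bounded_op_poly[OF H this] hs_0[OF H]] True show ?thesis by simp
next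
  case False
  have T': "bounded_op H H T" using T by (simp add: symmetric_op_def)
  have "op_norm H (op_poly r T) \<le> B"
  proof (cases "r * r = [:(op_norm H (op_poly r T))\<^sup>2:]")
    case True
    \<comment> \<open>Here \<open>r\<^sup>2\<close> is constant, and it only matters that the real spectrum is not empty.\<close>
    let ?X = "[:0, 1:] :: real poly"
    have "?X * ?X \<noteq> [:(op_norm H (op_poly ?X T))\<^sup>2:]" by simp
    from op_poly_norm_attained[OF H T x False this]
    obtain t where "complex_of_real t \<in> op_spectrum H T" by blast
    from B(2)[OF this] have "\<bar>poly r t\<bar> \<le> B" .
    moreover have "(poly r t)\<^sup>2 = (op_norm H (op_poly r T))\<^sup>2"
      using arg_cong[OF True, of "\<lambda>p. poly p t"] by (simp add: power2_eq_square)
    ultimately show ?thesis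
      using op_norm_nonneg[OF H bounded_op_poly[OF H T']] by (metis abs_of_nonneg power2_eq_iff abs_minus_cancel)
  next
    case False
    from op_poly_norm_attained[OF H T x \<open>x \<noteq> 0\<close> this] B(2) show ?thesis by metis
  qed
  then show ?thesis
    using op_norm_bound[OF H bounded_op_poly[OF H T'] x] by (meson mult_right_mono norm_ge_zero order_trans)
qed

section \<open>Continuous functional calculus of a positive operator\<close>

text \<open>Bounded symmetric operators on \<open>H\<close> with a nonnegative quadratic form.\<close>

definition positive_op :: "'a::complex_hilbert set \<Rightarrow> ('a \<Rightarrow> 'a) \<Rightarrow> bool" where
  "positive_op H T \<longleftrightarrow> symmetric_op H T \<and> (\<forall>x\<in>H. 0 \<le> inner (T x) x)"

lemma positive_op_bounded: "positive_op H T \<Longrightarrow> bounded_op H H T"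
  by (simp add: positive_op_def symmetric_op_def)

lemma positive_op_spectrum:
  assumes H: "hilbert_subspace H" and T: "positive_op H T"
    and M: "\<And>x. x \<in> H \<Longrightarrow> norm (T x) \<le> M * norm x" and t: "complex_of_real t \<in> op_spectrum H T"
  shows "t \<in> {0..M}"
proof (rule ccontr)
  assume "t \<notin> {0..M}"
  then consider "t < 0" | "M < t" by fastforce
  then have "complex_of_real t \<notin> op_spectrum H T"
  proof cases
    case 1
    show ?thesis
    proof (rule not_in_spectrum[OF H positive_op_bounded[OF T], of "- t" 1])
      fix x assume "x \<in> H"
      then show "- t * (norm x)\<^sup>2 \<le> 1 * inner (T x - t *\<^sub>R x) x"
        using T by (simp add: positive_op_def inner_diff_left dot_square_norm)
    qed (use 1 in simp)
  next
    case 2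
    show ?thesis
    proof (rule not_in_spectrum[OF H positive_op_bounded[OF T], of "t - M" "- 1"])
      fix x assume x: "x \<in> H"
      have "inner (T x) x \<le> norm (T x) * norm x" by (rule norm_cauchy_schwarz)
      also have "\<dots> \<le> M * norm x * norm x" by (rule mult_right_mono[OF M[OF x]]) simp
      finally show "(t - M) * (norm x)\<^sup>2 \<le> - 1 * inner (T x - t *\<^sub>R x) x"
        by (simp add: inner_diff_left dot_square_norm power2_eq_square algebra_simps)
    qed (use 2 in simp)
  qed
  then show False using t by simp
qed

lemma polynomial_approximation:
  fixes f :: "real \<Rightarrow> real"
  assumes "continuous_on {a..b} f"
  shows "\<exists>p. uniform_limit {a..b} (\<lambda>n. poly (p n)) f sequentially"
proof -
  have "\<exists>p. \<forall>x\<in>{a..b}. \<bar>f x - poly p x\<bar> < inverse (real (Suc n))" for n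
  proof -
    obtain g where g: "real_polynomial_function g"
      "\<And>x. x \<in> {a..b} \<Longrightarrow> \<bar>f x - g x\<bar> < inverse (real (Suc n))"
      using Stone_Weierstrass_real_polynomial_function[OF compact_Icc assms, of "inverse (real (Suc n))"]
      by auto
    obtain c m where "g = (\<lambda>x. \<Sum>i\<le>m. c i * x ^ i)"
      using g(1) unfolding real_polynomial_function_iff_sum by blast
    then have "g = poly (\<Sum>i\<le>m. monom (c i) i)"
      by (simp add: fun_eq_iff poly_sum poly_monom)
    then show ?thesis using g(2) by blast
  qed
  then obtain p where p: "\<And>n x. x \<in> {a..b} \<Longrightarrow> \<bar>f x - poly (p n) x\<bar> < inverse (real (Suc n))"
    by metis
  have "uniform_limit {a..b} (\<lambda>n. poly (p n)) f sequentially"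
  proof (rule uniform_limitI)
    fix e :: real assume "0 < e"
    then obtain N where N: "inverse (real (Suc N)) < e" using reals_Archimedean by blast
    show "\<forall>\<^sub>F n in sequentially. \<forall>x\<in>{a..b}. dist (poly (p n) x) (f x) < e"
    proof (rule eventually_sequentiallyI[of N], rule ballI)
      fix n x assume "N \<le> n" "x \<in> {a..b}"
      have "\<bar>f x - poly (p n) x\<bar> < inverse (real (Suc n))" using p[OF \<open>x \<in> {a..b}\<close>] .
      also have "\<dots> \<le> inverse (real (Suc N))" using \<open>N \<le> n\<close> by simp
      also have "\<dots> < e" by (rule N)
      finally show "dist (poly (p n) x) (f x) < e" by (simp add: dist_real_def abs_minus_commute)
    qed
  qed
  then show ?thesis by blast
qed

text \<open>The property that characterises \<open>f(T)\<close> in the definition of the functional calculus.\<close>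

definition is_op_fun ::
  "'a::complex_hilbert set \<Rightarrow> (real \<Rightarrow> real) \<Rightarrow> ('a \<Rightarrow> 'a) \<Rightarrow> ('a \<Rightarrow> 'a) \<Rightarrow> bool" where
  "is_op_fun H f T S \<longleftrightarrow> bounded_op H H S \<and> S \<in> extensional H \<and>
     (\<exists>p :: nat \<Rightarrow> real poly.
        uniform_limit {t. complex_of_real t \<in> op_spectrum H T} (\<lambda>n. poly (p n)) f sequentially \<and>
        (\<lambda>n. op_norm H (\<lambda>x. op_poly (p n) T x - S x)) \<longlonglongrightarrow> 0)"

lemma op_norm_tendsto_pointwise:
  assumes H: "hilbert_subspace H" and "\<And>n. bounded_op H H (P n)" "bounded_op H H S"
    and "(\<lambda>n. op_norm H (\<lambda>x. P n x - S x)) \<longlonglongrightarrow> 0" and x: "x \<in> H"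
  shows "(\<lambda>n. P n x) \<longlonglongrightarrow> S x"
proof (rule LIM_zero_cancel, rule Lim_null_comparison)
  show "\<forall>\<^sub>F n in sequentially. norm (P n x - S x) \<le> op_norm H (\<lambda>x. P n x - S x) * norm x"
    by (intro always_eventually allI op_norm_bound[OF H bounded_op_diff[OF H] x] assms)
  show "(\<lambda>n. op_norm H (\<lambda>x. P n x - S x) * norm x) \<longlonglongrightarrow> 0"
    by (rule tendsto_mult_left_zero[OF assms(4)])
qed

lemma is_op_fun_unique:
  assumes H: "hilbert_subspace H" and T: "symmetric_op H T"
    and 1: "is_op_fun H f T S1" and 2: "is_op_fun H f T S2"
  shows "S1 = S2"
proof -
  let ?\<sigma> = "{t. complex_of_real t \<in> op_spectrum H T}"
  have T': "bounded_op H H T" using T by (simp add: symmetric_op_def)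
  note P = bounded_op_poly[OF H T']
  obtain p where S1: "bounded_op H H S1" "S1 \<in> extensional H"
    and p: "uniform_limit ?\<sigma> (\<lambda>n. poly (p n)) f sequentially"
      "(\<lambda>n. op_norm H (\<lambda>x. op_poly (p n) T x - S1 x)) \<longlonglongrightarrow> 0"
    using 1 unfolding is_op_fun_def by blast
  obtain q where S2: "bounded_op H H S2" "S2 \<in> extensional H"
    and q: "uniform_limit ?\<sigma> (\<lambda>n. poly (q n)) f sequentially"
      "(\<lambda>n. op_norm H (\<lambda>x. op_poly (q n) T x - S2 x)) \<longlonglongrightarrow> 0"
    using 2 unfolding is_op_fun_def by blast
  have "S1 x = S2 x" if x: "x \<in> H" for x
  proof -
    have lim: "(\<lambda>n. op_poly (p n) T x - op_poly (q n) T x) \<longlonglongrightarrow> S1 x - S2 x"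
      by (intro tendsto_diff op_norm_tendsto_pointwise[OF H P _ _ x] S1 S2 p q)
    have "(\<lambda>n. op_poly (p n) T x - op_poly (q n) T x) \<longlonglongrightarrow> 0"
    proof (rule tendstoI)
      fix e :: real assume e: "0 < e"
      define d where "d = e / (norm x + 1)"
      have d: "0 < d" using e by (simp add: d_def add_nonneg_pos)
      have "\<forall>\<^sub>F n in sequentially. \<forall>t\<in>?\<sigma>. dist (poly (p n) t) (f t) < d / 2"
        "\<forall>\<^sub>F n in sequentially. \<forall>t\<in>?\<sigma>. dist (poly (q n) t) (f t) < d / 2"
        using d by (intro uniform_limitD[OF p(1)] uniform_limitD[OF q(1)]; simp)+
      then show "\<forall>\<^sub>F n in sequentially. dist (op_poly (p n) T x - op_poly (q n) T x) 0 < e"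
      proof eventually_elim
        case (elim n)
        have "norm (op_poly (p n - q n) T x) \<le> d * norm x"
        proof (rule op_poly_norm_le[OF H T _ _ x])
          fix t assume "complex_of_real t \<in> op_spectrum H T"
          then have "\<bar>poly (p n) t - f t\<bar> < d / 2" "\<bar>poly (q n) t - f t\<bar> < d / 2"
            using elim by (auto simp: dist_real_def)
          then show "\<bar>poly (p n - q n) t\<bar> \<le> d" unfolding poly_diff by linarith
        qed (use d in simp)
        also have "\<dots> = e * (norm x / (norm x + 1))" by (simp add: d_def)
        also have "\<dots> < e * 1" using e by (intro mult_strict_left_mono) (auto simp: add_nonneg_pos)
        finally show ?case by (simp add: op_poly_diff)
      qed
    qed
    from LIMSEQ_unique[OF lim this] show ?thesis by simp
  qed
  then show ?thesis using S1(2) S2(2) by (rule extensionalityI[rotated 2])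
qed

lemma is_op_fun_limit:
  assumes H: "hilbert_subspace H" and T: "positive_op H T"
    and M: "\<And>x. x \<in> H \<Longrightarrow> norm (T x) \<le> M * norm x"
    and p: "uniform_limit {0..M} (\<lambda>n. poly (p n)) f sequentially"
  shows "\<exists>S. is_op_fun H f T S \<and> (\<forall>x\<in>H. (\<lambda>n. op_poly (p n) T x) \<longlonglongrightarrow> S x)"
proof -
  have T': "bounded_op H H T" and Ts: "symmetric_op H T"
    using T by (simp_all add: positive_op_bounded positive_op_def)
  note P = bounded_op_poly[OF H T']
  note spec = positive_op_spectrum[OF H T M]
  have cauchy: "\<exists>N. \<forall>m\<ge>N. \<forall>n\<ge>N. \<forall>x\<in>H. norm (op_poly (p m) T x - op_poly (p n) T x) \<le> e * norm x"
    if e: "0 < e" for e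
  proof -
    have "\<forall>\<^sub>F n in sequentially. \<forall>t\<in>{0..M}. dist (poly (p n) t) (f t) < e / 2"
      using e by (intro uniform_limitD[OF p]) simp
    then obtain N where N: "\<And>n t. N \<le> n \<Longrightarrow> t \<in> {0..M} \<Longrightarrow> dist (poly (p n) t) (f t) < e / 2"
      unfolding eventually_sequentially by blast
    have "norm (op_poly (p m - p n) T x) \<le> e * norm x" if "N \<le> m" "N \<le> n" "x \<in> H" for m n x
    proof (rule op_poly_norm_le[OF H Ts _ _ that(3)])
      fix t assume "complex_of_real t \<in> op_spectrum H T"
      then have t: "t \<in> {0..M}" by (rule spec[rotated])
      show "\<bar>poly (p m - p n) t\<bar> \<le> e"
        using N[OF that(1) t] N[OF that(2) t] unfolding poly_diff dist_real_def by linarith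
    qed (use e in simp)
    then show ?thesis by (auto simp: op_poly_diff)
  qed
  define S where "S = restrict (\<lambda>x. lim (\<lambda>n. op_poly (p n) T x)) H"
  have lim: "(\<lambda>n. op_poly (p n) T x) \<longlonglongrightarrow> S x" if x: "x \<in> H" for x
  proof -
    have "Cauchy (\<lambda>n. op_poly (p n) T x)"
    proof (rule CauchyI)
      fix e :: real assume e: "0 < e"
      define d where "d = e / (norm x + 1)"
      have d: "0 < d" using e by (simp add: d_def add_nonneg_pos)
      have "d * norm x = e * (norm x / (norm x + 1))" by (simp add: d_def)
      also have "\<dots> < e * 1" using e by (intro mult_strict_left_mono) (auto simp: add_nonneg_pos)
      finally have "d * norm x < e" by simp
      then show "\<exists>N. \<forall>m\<ge>N. \<forall>n\<ge>N. norm (op_poly (p m) T x - op_poly (p n) T x) < e"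
        using cauchy[OF d] x by (meson order.strict_trans1)
    qed
    then show ?thesis
      using x by (simp add: S_def Cauchy_convergent_iff convergent_LIMSEQ_iff)
  qed
  have uniform: "\<exists>N. \<forall>n\<ge>N. \<forall>x\<in>H. norm (op_poly (p n) T x - S x) \<le> e * norm x" if e: "0 < e" for e
  proof -
    obtain N where N: "\<And>m n x. N \<le> m \<Longrightarrow> N \<le> n \<Longrightarrow> x \<in> H \<Longrightarrow>
        norm (op_poly (p m) T x - op_poly (p n) T x) \<le> e * norm x"
      using cauchy[OF e] by blast
    have "norm (op_poly (p n) T x - S x) \<le> e * norm x" if "N \<le> n" "x \<in> H" for n x
    proof (rule LIMSEQ_le_const2)
      show "(\<lambda>m. norm (op_poly (p n) T x - op_poly (p m) T x)) \<longlonglongrightarrow> norm (op_poly (p n) T x - S x)"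
        by (intro tendsto_intros lim that)
      show "\<exists>N. \<forall>m\<ge>N. norm (op_poly (p n) T x - op_poly (p m) T x) \<le> e * norm x"
        using N that by blast
    qed
    then show ?thesis by blast
  qed
  have S: "bounded_op H H S"
  proof -
    obtain N where N: "\<And>x. x \<in> H \<Longrightarrow> norm (op_poly (p N) T x - S x) \<le> 1 * norm x"
      using uniform[of 1] by auto
    obtain B where B: "\<And>x. x \<in> H \<Longrightarrow> norm (op_poly (p N) T x) \<le> B * norm x"
      using op_bound[OF P] by blast
    show ?thesis
    proof (rule bounded_opI[of _ _ _ "B + 1"])
      fix x assume x: "x \<in> H"
      show "S x \<in> H" using hs_lim[OF H op_mem[OF P x] lim[OF x]] .
      show "norm (S x) \<le> (B + 1) * norm x"
        using N[OF x] B[OF x] norm_triangle_ineq3[of "op_poly (p N) T x" "S x"]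
        by (simp add: distrib_right)
      fix c
      have "(\<lambda>n. op_poly (p n) T (c *\<^sub>C x)) \<longlonglongrightarrow> c *\<^sub>C S x"
        unfolding op_scaleC[OF P x]
        by (rule bounded_linear.tendsto[OF bounded_linear_scaleC lim[OF x]])
      then show "S (c *\<^sub>C x) = c *\<^sub>C S x"
        using LIMSEQ_unique lim[OF hs_scaleC[OF H x]] by blast
    next
      fix x y assume x: "x \<in> H" and y: "y \<in> H"
      have "(\<lambda>n. op_poly (p n) T (x + y)) \<longlonglongrightarrow> S x + S y"
        unfolding op_add[OF P x y] by (intro tendsto_add lim x y)
      then show "S (x + y) = S x + S y"
        using LIMSEQ_unique lim[OF hs_add[OF H x y]] by blast
    qed
  qed
  have "(\<lambda>n. op_norm H (\<lambda>x. op_poly (p n) T x - S x)) \<longlonglongrightarrow> 0"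
  proof (rule LIMSEQ_I)
    fix e :: real assume e: "0 < e"
    obtain N where N: "\<And>n x. N \<le> n \<Longrightarrow> x \<in> H \<Longrightarrow> norm (op_poly (p n) T x - S x) \<le> e / 2 * norm x"
      using uniform[of "e / 2"] e by auto
    have "norm (op_norm H (\<lambda>x. op_poly (p n) T x - S x) - 0) < e" if "N \<le> n" for n
    proof -
      have "op_norm H (\<lambda>x. op_poly (p n) T x - S x) \<le> e / 2"
        using e by (intro op_norm_le[OF H] N that) auto
      then show ?thesis using op_norm_nonneg[OF H bounded_op_diff[OF H P S]] e by simp
    qed
    then show "\<exists>N. \<forall>n\<ge>N. norm (op_norm H (\<lambda>x. op_poly (p n) T x - S x) - 0) < e" by blast
  qed
  moreover have "uniform_limit {t. complex_of_real t \<in> op_spectrum H T} (\<lambda>n. poly (p n)) f sequentially"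
    by (rule uniform_limit_on_subset[OF p]) (use spec in blast)
  moreover have "S \<in> extensional H" by (simp add: S_def)
  ultimately have "is_op_fun H f T S" using S unfolding is_op_fun_def by blast
  then show ?thesis using lim by blast
qed

text \<open>All further properties of \<open>f(T)\<close> follow from this strong limit. The bound \<open>M\<close> and the
  polynomials are arbitrary, so that several operators can share them.\<close>

lemma op_fun_limit:
  assumes H: "hilbert_subspace H" and T: "positive_op H T"
    and M: "\<And>x. x \<in> H \<Longrightarrow> norm (T x) \<le> M * norm x"
    and p: "uniform_limit {0..M} (\<lambda>n. poly (p n)) f sequentially" and x: "x \<in> H"
  shows "(\<lambda>n. op_poly (p n) T x) \<longlonglongrightarrow> op_fun H f T x"
proof -
  obtain S where S: "is_op_fun H f T S" "\<And>x. x \<in> H \<Longrightarrow> (\<lambda>n. op_poly (p n) T x) \<longlonglongrightarrow> S x"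
    using is_op_fun_limit[OF H T M p] by blast
  have "op_fun H f T = S"
    unfolding op_fun_def is_op_fun_def[symmetric]
  proof (rule the_equality)
    show "R = S" if "is_op_fun H f T R" for R
      using is_op_fun_unique[OF H _ that S(1)] T by (simp add: positive_op_def)
  qed (rule S(1))
  then show ?thesis using S(2)[OF x] by simp
qed

lemma op_fun_approximation:
  assumes "continuous_on {0..} (f :: real \<Rightarrow> real)"
  obtains p where "uniform_limit {0..M} (\<lambda>n. poly (p n)) f sequentially"
  using polynomial_approximation[OF continuous_on_subset[OF assms, of "{0..M}"]] by auto

context
  fixes H :: "'a::complex_hilbert set" and T :: "'a \<Rightarrow> 'a"
  assumes H: "hilbert_subspace H" and T: "positive_op H T"
begin

lemma symmetric_op_fun:
  assumes f: "continuous_on {0..} f"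
  shows "symmetric_op H (op_fun H f T)"
proof -
  obtain M where M: "\<And>x. x \<in> H \<Longrightarrow> norm (T x) \<le> M * norm x"
    using op_bound[OF positive_op_bounded[OF T]] by blast
  obtain p where p: "uniform_limit {0..M} (\<lambda>n. poly (p n)) f sequentially"
    using op_fun_approximation[OF f] by blast
  obtain S where S: "is_op_fun H f T S" "\<And>x. x \<in> H \<Longrightarrow> (\<lambda>n. op_poly (p n) T x) \<longlonglongrightarrow> S x"
    using is_op_fun_limit[OF H T M p] by blast
  have eq: "op_fun H f T x = S x" if "x \<in> H" for x
    using LIMSEQ_unique[OF op_fun_limit[OF H T M p that] S(2)[OF that]] .
  have "bounded_op H H S" using S(1) by (simp add: is_op_fun_def)
  then have "bounded_op H H (op_fun H f T)"
    by (simp add: bounded_op_def eq hs_add[OF H] hs_scaleC[OF H] Pi_def)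
  moreover have "inner (op_fun H f T x) y = inner x (op_fun H f T y)" if x: "x \<in> H" and y: "y \<in> H" for x y
  proof -
    have "symmetric_op H (op_poly q T)" for q
      using symmetric_op_poly[OF H] T by (simp add: positive_op_def)
    then have "inner (op_poly (p n) T x) y = inner x (op_poly (p n) T y)" for n
      using x y by (simp add: symmetric_op_def)
    moreover have "(\<lambda>n. inner (op_poly (p n) T x) y) \<longlonglongrightarrow> inner (op_fun H f T x) y"
      by (intro tendsto_intros op_fun_limit[OF H T M p x])
    moreover have "(\<lambda>n. inner x (op_poly (p n) T y)) \<longlonglongrightarrow> inner x (op_fun H f T y)"
      by (intro tendsto_intros op_fun_limit[OF H T M p y])
    ultimately show ?thesis using LIMSEQ_unique by simp
  qed
  ultimately show ?thesis by (simp add: symmetric_op_def)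
qed

lemma bounded_op_fun: "continuous_on {0..} f \<Longrightarrow> bounded_op H H (op_fun H f T)"
  using symmetric_op_fun by (simp add: symmetric_op_def)

lemma inner_op_fun:
  "continuous_on {0..} f \<Longrightarrow> x \<in> H \<Longrightarrow> y \<in> H \<Longrightarrow> inner (op_fun H f T x) y = inner x (op_fun H f T y)"
  using symmetric_op_fun by (simp add: symmetric_op_def)

lemma op_fun_ident:
  assumes h: "\<And>t. 0 \<le> t \<Longrightarrow> h t = t" and x: "x \<in> H"
  shows "op_fun H h T x = T x"
proof -
  obtain M where M: "\<And>x. x \<in> H \<Longrightarrow> norm (T x) \<le> M * norm x"
    using op_bound[OF positive_op_bounded[OF T]] by blast
  have "uniform_limit {0..M} (\<lambda>n. poly [:0, 1:]) h sequentially"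
    by (rule uniform_limitI) (simp add: h)
  from op_fun_limit[OF H T M this x] have "(\<lambda>n::nat. T x) \<longlonglongrightarrow> op_fun H h T x"
    by (simp add: op_poly_pCons)
  then show ?thesis using LIMSEQ_unique tendsto_const by blast
qed

text \<open>Multiplicativity: test against vectors of \<open>H\<close>, so that only strong limits are needed.\<close>

lemma op_fun_mult:
  assumes f: "continuous_on {0..} f" and g: "continuous_on {0..} g"
    and h: "\<And>t. 0 \<le> t \<Longrightarrow> f t * g t = h t" and x: "x \<in> H"
  shows "op_fun H f T (op_fun H g T x) = op_fun H h T x"
proof -
  note T' = positive_op_bounded[OF T]
  note P = bounded_op_poly[OF H T']
  obtain M where M: "\<And>x. x \<in> H \<Longrightarrow> norm (T x) \<le> M * norm x" using op_bound[OF T'] by blast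
  obtain p where p: "uniform_limit {0..M} (\<lambda>n. poly (p n)) f sequentially"
    using op_fun_approximation[OF f] by blast
  obtain q where q: "uniform_limit {0..M} (\<lambda>n. poly (q n)) g sequentially"
    using op_fun_approximation[OF g] by blast
  have sub: "{0..M} \<subseteq> {0..}" by auto
  have "bounded (f ` {0..M})" "bounded (g ` {0..M})"
    using compact_continuous_image[OF continuous_on_subset[OF f sub] compact_Icc]
      compact_continuous_image[OF continuous_on_subset[OF g sub] compact_Icc]
    by (auto intro: compact_imp_bounded)
  from uniform_lim_mult[OF p q this]
  have pq: "uniform_limit {0..M} (\<lambda>n. poly (p n * q n)) h sequentially"
    using uniform_limit_cong'[of "{0..M}" "\<lambda>n t. poly (p n) t * poly (q n) t"
        "\<lambda>n. poly (p n * q n)" "\<lambda>t. f t * g t" h sequentially] by (simp add: h)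
  have hcont: "continuous_on {0..} h"
    using continuous_on_mult[OF f g] by (rule continuous_on_eq) (simp add: h)
  show ?thesis
  proof (rule eq_if_inner_eq[OF H])
    show "op_fun H f T (op_fun H g T x) \<in> H"
      by (intro op_mem[OF bounded_op_fun] f g x)
    show "op_fun H h T x \<in> H"
      by (rule op_mem[OF bounded_op_fun[OF hcont] x])
    fix y assume y: "y \<in> H"
    have "inner (op_poly (p n) T y) (op_poly (q n) T x) = inner y (op_poly (p n * q n) T x)" for n
      using symmetric_op_poly[OF H, of T "p n"] T y op_mem[OF P x]
      by (simp add: op_poly_mult[OF H T' x] positive_op_def symmetric_op_def)
    moreover have "(\<lambda>n. inner (op_poly (p n) T y) (op_poly (q n) T x))
        \<longlonglongrightarrow> inner (op_fun H f T y) (op_fun H g T x)"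
      by (intro tendsto_intros op_fun_limit[OF H T M p y] op_fun_limit[OF H T M q x])
    moreover have "(\<lambda>n. inner y (op_poly (p n * q n) T x)) \<longlonglongrightarrow> inner y (op_fun H h T x)"
      by (intro tendsto_intros op_fun_limit[OF H T M pq x])
    ultimately have "inner (op_fun H f T y) (op_fun H g T x) = inner y (op_fun H h T x)"
      using LIMSEQ_unique by simp
    then show "inner y (op_fun H f T (op_fun H g T x)) = inner y (op_fun H h T x)"
      using inner_op_fun[OF f y op_mem[OF bounded_op_fun[OF g] x]] by simp
  qed
qed

lemma positive_op_fun:
  assumes f: "continuous_on {0..} f" and pos: "\<And>t. 0 \<le> t \<Longrightarrow> 0 \<le> f t"
  shows "positive_op H (op_fun H f T)"
proof -
  \<comment> \<open>\<open>f(T)\<close> is the square of the symmetric operator \<open>(sqrt \<circ> f)(T)\<close>.\<close>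
  have r: "continuous_on {0..} (\<lambda>t. sqrt (f t))" by (intro continuous_intros f)
  have "0 \<le> inner (op_fun H f T x) x" if x: "x \<in> H" for x
  proof -
    have "op_fun H f T x = op_fun H (\<lambda>t. sqrt (f t)) T (op_fun H (\<lambda>t. sqrt (f t)) T x)"
      by (rule op_fun_mult[OF r r _ x, symmetric]) (simp add: pos)
    then show ?thesis using inner_op_fun[OF r op_mem[OF bounded_op_fun[OF r] x] x] by simp
  qed
  then show ?thesis using symmetric_op_fun[OF f] by (simp add: positive_op_def)
qed

end

text \<open>The same polynomials approximate \<open>f\<close> for both operators, on an interval given by a common
  bound of their norms.\<close>

lemma op_fun_intertwine:
  assumes H: "hilbert_subspace H" and T: "positive_op H T" and R: "positive_op H R"
    and X: "bounded_op H H X" and comm: "\<And>x. x \<in> H \<Longrightarrow> X (T x) = R (X x)"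
    and f: "continuous_on {0..} f" and x: "x \<in> H"
  shows "X (op_fun H f T x) = op_fun H f R (X x)"
proof -
  note T' = positive_op_bounded[OF T]
  note P = bounded_op_poly[OF H T']
  obtain M1 where M1: "0 \<le> M1" "\<And>x. x \<in> H \<Longrightarrow> norm (T x) \<le> M1 * norm x"
    using op_bound[OF T'] by blast
  obtain M2 where M2: "0 \<le> M2" "\<And>x. x \<in> H \<Longrightarrow> norm (R x) \<le> M2 * norm x"
    using op_bound[OF positive_op_bounded[OF R]] by blast
  define M where "M = M1 + M2"
  have M: "norm (T x) \<le> M * norm x" "norm (R x) \<le> M * norm x" if "x \<in> H" for x
  proof -
    have "M1 * norm x \<le> M * norm x" "M2 * norm x \<le> M * norm x"
      using M1(1) M2(1) by (simp_all add: M_def mult_right_mono)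
    then show "norm (T x) \<le> M * norm x" "norm (R x) \<le> M * norm x"
      using M1(2)[OF that] M2(2)[OF that] by linarith+
  qed
  obtain p where p: "uniform_limit {0..M} (\<lambda>n. poly (p n)) f sequentially"
    using op_fun_approximation[OF f] by blast
  have "X (op_poly q T x) = op_poly q R (X x)" if "x \<in> H" for q x
    using that
  proof (induction q arbitrary: x)
    case 0
    then show ?case by (simp add: op_0[OF X hs_0[OF H]])
  next
    case (pCons a q)
    then show ?case
      using op_mem[OF T'] op_mem[OF P]
      by (simp add: op_poly_pCons op_add[OF X] op_scaleR[OF X] hs_scaleR[OF H] comm)
  qed
  then have "X (op_poly (p n) T x) = op_poly (p n) R (X x)" for n using x by blast
  moreover have "(\<lambda>n. X (op_poly (p n) T x)) \<longlonglongrightarrow> X (op_fun H f T x)"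
    by (intro op_tendsto[OF H X] op_mem[OF P] x op_fun_limit[OF H T M(1) p]
        op_mem[OF bounded_op_fun[OF H T f]])
  moreover have "(\<lambda>n. op_poly (p n) R (X x)) \<longlonglongrightarrow> op_fun H f R (X x)"
    by (rule op_fun_limit[OF H R M(2) p op_mem[OF X x]])
  ultimately show ?thesis using LIMSEQ_unique by simp
qed

section \<open>Absolute values and the mixed Schwarz inequality\<close>

lemma continuous_on_sqrt_nonneg: "continuous_on {0..} sqrt"
  by (intro continuous_intros)

context
  fixes H :: "'a::complex_hilbert set" and X :: "'a \<Rightarrow> 'a"
  assumes H: "hilbert_subspace H" and X: "bounded_op H H X"
begin

lemma positive_op_adjoint_comp: "positive_op H (op_adjoint H X \<circ> X)"
proof -
  have "inner (op_adjoint H X (X x)) y = inner (X x) (X y)" if "x \<in> H" "y \<in> H" for x y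
    using inner_op_adjoint[OF H X that(2), of "X x"] by (simp add: inner_commute)
  moreover have "inner x (op_adjoint H X (X y)) = inner (X x) (X y)" if "x \<in> H" "y \<in> H" for x y
    using inner_op_adjoint[OF H X that(1)] by simp
  ultimately show ?thesis
    using bounded_op_comp[OF X bounded_op_adjoint[OF H X]]
    by (simp add: positive_op_def symmetric_op_def)
qed

lemma positive_op_abs: "positive_op H (op_abs H X)"
  unfolding op_abs_def
  by (rule positive_op_fun[OF H positive_op_adjoint_comp continuous_on_sqrt_nonneg]) simp

lemma op_abs_op_abs:
  assumes "x \<in> H"
  shows "op_abs H X (op_abs H X x) = op_adjoint H X (X x)"
proof -
  note P = positive_op_adjoint_comp
  have "op_abs H X (op_abs H X x) = op_fun H (\<lambda>t. t) (op_adjoint H X \<circ> X) x"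
    unfolding op_abs_def
    by (rule op_fun_mult[OF H P continuous_on_sqrt_nonneg continuous_on_sqrt_nonneg _ assms]) simp
  then show ?thesis by (simp add: op_fun_ident[OF H P _ assms])
qed

lemma norm_op_abs:
  assumes x: "x \<in> H"
  shows "norm (op_abs H X x) = norm (X x)"
proof -
  have P: "bounded_op H H (op_abs H X)" "\<And>y. y \<in> H \<Longrightarrow> inner (op_abs H X x) y = inner x (op_abs H X y)"
    using positive_op_abs x by (auto simp: positive_op_def symmetric_op_def)
  have "inner (op_abs H X x) (op_abs H X x) = inner x (op_adjoint H X (X x))"
    using P(2)[OF op_mem[OF P(1) x]] op_abs_op_abs[OF x] by simp
  also have "\<dots> = inner (X x) (X x)"
    using inner_op_adjoint[OF H X x] by simp
  finally show ?thesis by (simp add: norm_eq_sqrt_inner)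
qed

end

lemma op_abs_intertwine:
  assumes H: "hilbert_subspace H" and X: "bounded_op H H X" and x: "x \<in> H"
  shows "X (op_abs H X x) = op_abs H (op_adjoint H X) (X x)"
  unfolding op_abs_def
proof (rule op_fun_intertwine[OF H positive_op_adjoint_comp[OF H X] _ X _ continuous_on_sqrt_nonneg x])
  show "positive_op H (op_adjoint H (op_adjoint H X) \<circ> op_adjoint H X)"
    by (rule positive_op_adjoint_comp[OF H bounded_op_adjoint[OF H X]])
  show "X ((op_adjoint H X \<circ> X) x) = (op_adjoint H (op_adjoint H X) \<circ> op_adjoint H X) (X x)"
    if "x \<in> H" for x
    using op_adjoint_adjoint[OF H X op_adjoint_mem[OF H X]] by simp
qed

lemma positive_op_add_scale:
  assumes H: "hilbert_subspace H" and P: "positive_op H P" and e: "0 < e"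
  shows positive_op_add_scale_norm: "u \<in> H \<Longrightarrow> norm (P u) \<le> norm (P u + e *\<^sub>R u)"
    and positive_op_add_scale_surj: "y \<in> H \<Longrightarrow> \<exists>u\<in>H. P u + e *\<^sub>R u = y"
proof -
  have pos: "\<And>x. x \<in> H \<Longrightarrow> 0 \<le> inner (P x) x" using P by (simp add: positive_op_def)
  show "norm (P u) \<le> norm (P u + e *\<^sub>R u)" if "u \<in> H"
  proof (rule power2_le_imp_le)
    have "(norm (P u + e *\<^sub>R u))\<^sup>2 = (norm (P u))\<^sup>2 + 2 * e * inner (P u) u + e\<^sup>2 * (norm u)\<^sup>2"
      unfolding power2_norm_eq_inner
      by (simp add: inner_add_left inner_add_right inner_commute power2_eq_square)
    then show "(norm (P u))\<^sup>2 \<le> (norm (P u + e *\<^sub>R u))\<^sup>2" using pos[OF that] e by simp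
  qed simp
  have "bounded_op H H (\<lambda>u. P u + e *\<^sub>R u)"
    by (intro bounded_op_add bounded_op_scaleR bounded_op_id H positive_op_bounded[OF P])
  then show "\<exists>u\<in>H. P u + e *\<^sub>R u = y" if "y \<in> H"
    by (rule coercive_surj[OF H _ e _ that])
      (use pos in \<open>simp add: inner_add_left dot_square_norm\<close>)
qed

text \<open>The factorisation \<open>X = G V F\<close> with a contraction \<open>V\<close> would give this at once.
  Instead of a polar decomposition of \<open>X\<close>, the argument uses the operators
  \<open>X (\<bar>X\<bar> + e)\<^sup>-\<^sup>1\<close> for small \<open>e\<close>, which are contractions.\<close>

lemma mixed_schwarz:
  assumes H: "hilbert_subspace H" and X: "bounded_op H H X"
    and f: "continuous_on {0..} f" and g: "continuous_on {0..} g"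
    and fg: "\<And>t. 0 \<le> t \<Longrightarrow> f t * g t = t" and x: "x \<in> H" and y: "y \<in> H"
  shows "cmod (cinner (X x) y) \<le>
    norm (op_fun H f (op_abs H X) x) * norm (op_fun H g (op_abs H (op_adjoint H X)) y)"
proof -
  define P where "P = op_abs H X"
  define Q where "Q = op_abs H (op_adjoint H X)"
  define F where "F = op_fun H f P"
  define G where "G = op_fun H g Q"
  define G' where "G' = op_fun H g P"
  have P: "positive_op H P" unfolding P_def by (rule positive_op_abs[OF H X])
  have Q: "positive_op H Q" unfolding Q_def by (rule positive_op_abs[OF H bounded_op_adjoint[OF H X]])
  note P' = positive_op_bounded[OF P]
  have F: "bounded_op H H F" unfolding F_def by (rule bounded_op_fun[OF H P f])
  have G': "bounded_op H H G'" unfolding G'_def by (rule bounded_op_fun[OF H P g])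
  have G: "bounded_op H H G" unfolding G_def by (rule bounded_op_fun[OF H Q g])
  have real: "inner (X x) y \<le> norm (F x) * norm (G y)" if x: "x \<in> H" for x
  proof (rule field_le_epsilon)
    fix d :: real assume d: "0 < d"
    \<comment> \<open>The error caused by \<open>e\<close> is \<open>e \<parallel>x\<parallel> \<parallel>y\<parallel>\<close>.\<close>
    define e where "e = d / (norm x * norm y + 1)"
    have e: "0 < e" using d by (simp add: e_def add_nonneg_pos)
    have "e * (norm x * norm y) = d * (norm x * norm y / (norm x * norm y + 1))" by (simp add: e_def)
    also have "\<dots> \<le> d * 1" using d by (intro mult_left_mono) (auto simp: add_nonneg_pos)
    finally have ed: "e * (norm x * norm y) \<le> d" by simp
    \<comment> \<open>With \<open>u = (P + e)\<^sup>-\<^sup>1 F x\<close>, the vector \<open>G' u\<close> tends to \<open>x\<close> up to the kernel of \<open>P\<close>,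
      which is the kernel of \<open>X\<close>, as \<open>e\<close> tends to 0; its defect \<open>w\<close> equals \<open>e (P + e)\<^sup>-\<^sup>1 x\<close>.\<close>
    obtain u where u: "u \<in> H" "P u + e *\<^sub>R u = F x"
      using positive_op_add_scale_surj[OF H P e op_mem[OF F x]] by blast
    have Pu: "P u \<in> H" by (rule op_mem[OF P' u(1)])
    have Gu: "G' u \<in> H" by (rule op_mem[OF G' u(1)])
    define w where "w = x - G' u"
    have w: "w \<in> H" unfolding w_def by (rule hs_diff[OF H x Gu])
    have "G' (F x) = op_fun H (\<lambda>t. t) P x"
      unfolding F_def G'_def by (rule op_fun_mult[OF H P g f _ x]) (metis fg mult.commute)
    then have "P x = G' (F x)" by (simp add: op_fun_ident[OF H P _ x])
    also have "\<dots> = G' (P u) + e *\<^sub>R G' u"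
      unfolding u(2)[symmetric] by (simp add: op_add[OF G'] op_scaleR[OF G'] hs_scaleR[OF H] Pu u(1))
    also have "G' (P u) = P (G' u)"
      unfolding G'_def by (rule op_fun_intertwine[OF H P P P' refl g u(1), symmetric])
    finally have "P w + e *\<^sub>R w = e *\<^sub>R x"
      by (simp add: w_def op_diff[OF H P' x Gu] scaleR_diff_right)
    then have "norm (P w) \<le> e * norm x"
      using positive_op_add_scale_norm[OF H P e w] e by simp
    then have Xw: "norm (X w) \<le> e * norm x"
      using norm_op_abs[OF H X w] by (simp add: P_def)
    have "norm (P u) \<le> norm (F x)"
      using positive_op_add_scale_norm[OF H P e u(1)] u(2) by simp
    then have Xu: "norm (X u) \<le> norm (F x)"
      using norm_op_abs[OF H X u(1)] by (simp add: P_def)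
    have "X (G' u) = G (X u)"
      unfolding G'_def G_def
      by (rule op_fun_intertwine[OF H P Q X _ g u(1)]) (simp add: P_def Q_def op_abs_intertwine[OF H X])
    then have "inner (X (G' u)) y = inner (X u) (G y)"
      using inner_op_fun[OF H Q g op_mem[OF X u(1)] y] by (simp add: G_def)
    then have "inner (X x) y = inner (X w) y + inner (X u) (G y)"
      by (simp add: w_def op_diff[OF H X x Gu] inner_diff_left)
    also have "inner (X w) y \<le> norm (X w) * norm y" by (rule norm_cauchy_schwarz)
    also have "\<dots> \<le> e * norm x * norm y" by (rule mult_right_mono[OF Xw]) simp
    also have "\<dots> \<le> d" using ed by (simp add: mult.assoc)
    also have "inner (X u) (G y) \<le> norm (X u) * norm (G y)" by (rule norm_cauchy_schwarz)
    also have "\<dots> \<le> norm (F x) * norm (G y)" by (rule mult_right_mono[OF Xu]) simp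
    finally show "inner (X x) y \<le> norm (F x) * norm (G y) + d" by simp
  qed
  have "cmod (cinner (X x) y) \<le> norm (F x) * norm (G y)"
  proof (rule cmod_cinner_le_by_rotation)
    fix c :: complex assume "cmod c = 1"
    then show "inner (c *\<^sub>C X x) y \<le> norm (F x) * norm (G y)"
      using real[OF hs_scaleC[OF H x], of c]
      by (simp add: op_scaleC[OF X x] op_scaleC[OF F x] norm_scaleC)
  qed
  then show ?thesis by (simp add: F_def G_def P_def Q_def)
qed

section \<open>The diagonal entries\<close>

text \<open>The largest eigenvalue of a real symmetric two by two matrix bounds its quadratic form.\<close>

lemma quadratic_form_le:
  fixes a b c p q :: real
  assumes "0 \<le> c"
  shows "a * p\<^sup>2 + b * q\<^sup>2 + 2 * c * p * q \<le> (a + b + sqrt ((a - b)\<^sup>2 + 4 * c\<^sup>2)) / 2 * (p\<^sup>2 + q\<^sup>2)"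
proof -
  define w where "w = sqrt ((a - b)\<^sup>2 + 4 * c\<^sup>2)"
  define l where "l = (a + b + w) / 2"
  define r where "r = l - a"
  define s where "s = l - b"
  have "\<bar>a - b\<bar> \<le> w" unfolding w_def by (rule real_le_rsqrt) simp
  then have r: "0 \<le> r" and s: "0 \<le> s" by (auto simp: r_def s_def l_def)
  have "4 * (r * s) = w\<^sup>2 - (a - b)\<^sup>2"
    by (simp add: r_def s_def l_def power2_eq_square field_simps)
  also have "w\<^sup>2 = (a - b)\<^sup>2 + 4 * c\<^sup>2" by (simp add: w_def)
  finally have "r * s = c\<^sup>2" by simp
  then have rs: "sqrt r * sqrt s = c" using assms by (metis real_sqrt_mult real_sqrt_abs abs_of_nonneg)
  have "0 \<le> (sqrt r * p - sqrt s * q)\<^sup>2" by simp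
  also have "\<dots> = (sqrt r)\<^sup>2 * p\<^sup>2 + (sqrt s)\<^sup>2 * q\<^sup>2 - 2 * (sqrt r * sqrt s) * p * q"
    by (simp add: power2_eq_square algebra_simps)
  finally have "a * p\<^sup>2 + b * q\<^sup>2 + 2 * c * p * q \<le> l * (p\<^sup>2 + q\<^sup>2)"
    using r s rs by (simp add: r_def s_def algebra_simps)
  then show ?thesis unfolding l_def w_def .
qed

text \<open>This is the inequality \<open>\<parallel>F\<^sup>2 + G\<^sup>2\<parallel> \<le> \<lambda>\<close>, where \<open>\<lambda>\<close> is the largest eigenvalue of the matrix
  with diagonal entries \<open>\<parallel>F\<^sup>2\<parallel>\<close>, \<open>\<parallel>G\<^sup>2\<parallel>\<close> and off-diagonal entries \<open>\<parallel>FG\<parallel>\<close>. It comes from the norm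
  of the row operator \<open>(y, z) \<mapsto> F y + G z\<close>, applied to \<open>y = F x\<close> and \<open>z = G x\<close>.\<close>

lemma norm_sum_squares_le:
  assumes H: "hilbert_subspace H" and F: "symmetric_op H F" and G: "symmetric_op H G" and x: "x \<in> H"
  defines "a \<equiv> op_norm H (F \<circ> F)" and "b \<equiv> op_norm H (G \<circ> G)" and "c \<equiv> op_norm H (F \<circ> G)"
  shows "(norm (F x))\<^sup>2 + (norm (G x))\<^sup>2 \<le> (a + b + sqrt ((a - b)\<^sup>2 + 4 * c\<^sup>2)) / 2 * (norm x)\<^sup>2"
proof -
  have F': "bounded_op H H F" and Fs: "\<And>x y. x \<in> H \<Longrightarrow> y \<in> H \<Longrightarrow> inner (F x) y = inner x (F y)"
    and G': "bounded_op H H G" and Gs: "\<And>x y. x \<in> H \<Longrightarrow> y \<in> H \<Longrightarrow> inner (G x) y = inner x (G y)"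
    using F G by (auto simp: symmetric_op_def)
  have sq: "(norm (S u))\<^sup>2 \<le> op_norm H (S \<circ> S) * (norm u)\<^sup>2" if S: "symmetric_op H S" and u: "u \<in> H" for S u
  proof -
    have S': "bounded_op H H S" using S by (simp add: symmetric_op_def)
    have "(norm (S u))\<^sup>2 = inner u (S (S u))"
      using S u op_mem[OF S' u] by (simp add: symmetric_op_def power2_norm_eq_inner)
    also have "\<dots> \<le> norm u * norm ((S \<circ> S) u)" using norm_cauchy_schwarz[of u] by simp
    also have "\<dots> \<le> norm u * (op_norm H (S \<circ> S) * norm u)"
      by (intro mult_left_mono op_norm_bound[OF H bounded_op_comp[OF S' S'] u]) simp
    finally show ?thesis by (simp add: power2_eq_square mult_ac)
  qed
  define l where "l = (a + b + sqrt ((a - b)\<^sup>2 + 4 * c\<^sup>2)) / 2"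
  have c0: "0 \<le> c" unfolding c_def by (rule op_norm_nonneg[OF H bounded_op_comp[OF G' F']])
  define y where "y = F x"
  define z where "z = G x"
  have y: "y \<in> H" and z: "z \<in> H" by (simp_all add: y_def z_def op_mem[OF F' x] op_mem[OF G' x])
  define N where "N = (norm y)\<^sup>2 + (norm z)\<^sup>2"
  have "inner (F y) (G z) = inner y ((F \<circ> G) z)"
    using Fs[OF y op_mem[OF G' z]] by simp
  also have "\<dots> \<le> norm y * norm ((F \<circ> G) z)" by (rule norm_cauchy_schwarz)
  also have "\<dots> \<le> norm y * (c * norm z)"
    unfolding c_def by (intro mult_left_mono op_norm_bound[OF H bounded_op_comp[OF G' F'] z]) simp
  finally have cross: "inner (F y) (G z) \<le> c * norm y * norm z" by (simp add: mult_ac)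
  have "(norm (F y + G z))\<^sup>2 = (norm (F y))\<^sup>2 + (norm (G z))\<^sup>2 + 2 * inner (F y) (G z)"
    unfolding power2_norm_eq_inner by (simp add: inner_add_left inner_add_right inner_commute)
  also have "\<dots> \<le> a * (norm y)\<^sup>2 + b * (norm z)\<^sup>2 + 2 * c * norm y * norm z"
    using sq[OF F y] sq[OF G z] cross by (simp add: a_def b_def)
  also have "\<dots> \<le> l * N"
    unfolding l_def N_def by (rule quadratic_form_le[OF c0])
  finally have row: "(norm (F y + G z))\<^sup>2 \<le> l * N" .
  have "N = inner (F y + G z) x"
    unfolding N_def power2_norm_eq_inner
    using Fs[OF y x] Gs[OF z x] by (simp add: inner_add_left y_def z_def)
  also have "\<dots> \<le> norm (F y + G z) * norm x" by (rule norm_cauchy_schwarz)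
  finally have "N\<^sup>2 \<le> (norm (F y + G z) * norm x)\<^sup>2"
    by (intro power_mono) (simp_all add: N_def)
  also have "\<dots> \<le> l * N * (norm x)\<^sup>2"
    unfolding power_mult_distrib by (rule mult_right_mono[OF row]) simp
  finally have "N * N \<le> N * (l * (norm x)\<^sup>2)" by (simp add: power2_eq_square mult_ac)
  moreover have "0 \<le> l"
  proof -
    have "0 \<le> a" "0 \<le> b"
      unfolding a_def b_def
      by (rule op_norm_nonneg[OF H bounded_op_comp[OF F' F']],
          rule op_norm_nonneg[OF H bounded_op_comp[OF G' G']])
    then show ?thesis by (simp add: l_def)
  qed
  moreover have "0 \<le> N" by (simp add: N_def)
  ultimately have "N \<le> l * (norm x)\<^sup>2" by (cases "N = 0") (simp_all add: mult_le_cancel_left)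
  then show ?thesis by (simp add: N_def l_def y_def z_def)
qed

lemma cmod_cinner_le_diag_bound:
  assumes H: "hilbert_subspace H" and X: "bounded_op H H X"
    and f: "continuous_on {0..} f" and g: "continuous_on {0..} g"
    and fg: "\<And>t. 0 \<le> t \<Longrightarrow> f t * g t = t" and x: "x \<in> H"
  shows "cmod (cinner (X x) x) \<le> 1 / 4 * diag_bound H f g X * (norm x)\<^sup>2"
proof -
  define F where "F = op_fun H f (op_abs H X)"
  define G where "G = op_fun H g (op_abs H (op_adjoint H X))"
  have F: "symmetric_op H F"
    unfolding F_def by (rule symmetric_op_fun[OF H positive_op_abs[OF H X] f])
  have G: "symmetric_op H G"
    unfolding G_def by (rule symmetric_op_fun[OF H positive_op_abs[OF H bounded_op_adjoint[OF H X]] g])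
  have "cmod (cinner (X x) x) \<le> norm (F x) * norm (G x)"
    unfolding F_def G_def by (rule mixed_schwarz[OF H X f g fg x x])
  also have "\<dots> \<le> ((norm (F x))\<^sup>2 + (norm (G x))\<^sup>2) / 2"
    using sum_squares_bound[of "norm (F x)" "norm (G x)"] by simp
  also have "\<dots> \<le> 1 / 4 * diag_bound H f g X * (norm x)\<^sup>2"
    using norm_sum_squares_le[OF H F G x] by (simp add: diag_bound_def Let_def F_def G_def)
  finally show ?thesis .
qed

section \<open>Operator matrices\<close>

lemma numerical_radius_upper:
  assumes T: "bounded_op H H T" and x: "x \<in> H" "norm x = 1"
  shows "cmod (cinner (T x) x) \<le> numerical_radius H T"
proof -
  obtain B where B: "0 \<le> B" "\<And>x. x \<in> H \<Longrightarrow> norm (T x) \<le> B * norm x" using op_bound[OF T] by blast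
  have "bdd_above (insert 0 {cmod (cinner (T x) x) | x. x \<in> H \<and> norm x = 1})"
  proof (rule bdd_aboveI[of _ B])
    fix r assume "r \<in> insert 0 {cmod (cinner (T x) x) | x. x \<in> H \<and> norm x = 1}"
    then consider "r = 0" | u where "r = cmod (cinner (T u) u)" "u \<in> H" "norm u = 1" by blast
    then show "r \<le> B"
    proof cases
      case (2 u)
      then show ?thesis using cmod_cinner_le[of "T u" u] B(2)[of u] by simp
    qed (use B(1) in simp)
  qed
  then show ?thesis unfolding numerical_radius_def using x by (intro cSup_upper) auto
qed

lemma bounded_op_matrix:
  fixes M :: "complex ^ 'n ^ 'm"
  shows "bounded_op UNIV UNIV ((*v) M)"
proof -
  have bl: "bounded_linear ((*v) M)" by simp
  obtain B where "\<And>x. norm (M *v x) \<le> norm x * B" using bounded_linear.bounded[OF bl] by blast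
  then show ?thesis
    by (intro bounded_opI[of _ _ _ B])
      (simp_all add: matrix_vector_right_distrib mult.commute, simp add: matrix_vector_mult_def
        scaleC_vec_def scaleC_complex_def vec_eq_iff sum_distrib_left mult_ac)
qed

lemma axis_add: "axis j (x + y) = axis j x + (axis j y :: 'a::ab_group_add ^ 'n)"
  by (simp add: axis_def vec_eq_iff)

lemma axis_scaleC: "axis j (c *\<^sub>C x) = c *\<^sub>C (axis j x :: 'a::complex_hilbert ^ 'n)"
  by (simp add: axis_def vec_eq_iff scaleC_vec_def)

lemma norm_axis: "norm (axis j x :: 'a::real_inner ^ 'n) = norm x"
  by (simp add: norm_eq_sqrt_inner inner_axis_axis)

lemma axis_in_hilbert_sum:
  assumes "\<And>i. hilbert_subspace (H i)" "x \<in> H j"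
  shows "axis j x \<in> hilbert_sum H"
  using assms by (simp add: hilbert_sum_def axis_def hs_0)

lemma bounded_op_entry:
  fixes H :: "'n::finite \<Rightarrow> 'a::complex_hilbert set"
  assumes H: "\<And>i. hilbert_subspace (H i)" and A: "bounded_op (hilbert_sum H) (hilbert_sum H) A"
  shows "bounded_op (H j) (H i) (op_entry A i j)"
proof -
  obtain B where B: "0 \<le> B" "\<And>x. x \<in> hilbert_sum H \<Longrightarrow> norm (A x) \<le> B * norm x"
    using op_bound[OF A] by blast
  note ax = axis_in_hilbert_sum[of H, OF H]
  show ?thesis
  proof (rule bounded_opI[of _ _ _ B])
    fix x assume x: "x \<in> H j"
    show "op_entry A i j x \<in> H i"
      using op_mem[OF A ax[OF x]] by (simp add: op_entry_def hilbert_sum_def)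
    show "norm (op_entry A i j x) \<le> B * norm x"
      using B(2)[OF ax[OF x]] Finite_Cartesian_Product.norm_nth_le[of "A (axis j x)" i]
      by (simp add: op_entry_def norm_axis)
    show "op_entry A i j (c *\<^sub>C x) = c *\<^sub>C op_entry A i j x" for c
      unfolding op_entry_def axis_scaleC op_scaleC[OF A ax[OF x]] by (simp add: scaleC_vec_def)
    show "op_entry A i j (x + y) = op_entry A i j x + op_entry A i j y" if "y \<in> H j" for y
      by (simp add: op_entry_def axis_add op_add[OF A ax[OF x] ax[OF that]])
  qed
qed

lemma op_matrix_apply:
  fixes H :: "'n::finite \<Rightarrow> 'a::complex_hilbert set"
  assumes H: "\<And>i. hilbert_subspace (H i)" and A: "bounded_op (hilbert_sum H) (hilbert_sum H) A"
    and x: "x \<in> hilbert_sum H"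
  shows "A x $ i = (\<Sum>j\<in>UNIV. op_entry A i j (x $ j))"
proof -
  have mem: "axis j (x $ j) \<in> hilbert_sum H" for j
    using x by (intro axis_in_hilbert_sum H) (simp add: hilbert_sum_def)
  have zero: "0 \<in> hilbert_sum H" by (simp add: hilbert_sum_def hs_0[OF H])
  have "(\<Sum>j\<in>J. axis j (x $ j)) \<in> hilbert_sum H \<and>
      A (\<Sum>j\<in>J. axis j (x $ j)) = (\<Sum>j\<in>J. A (axis j (x $ j)))" for J :: "'n set"
    using finite[of J]
  proof (induction J rule: finite_induct)
    case empty
    then show ?case using zero op_0[OF A zero] by simp
  next
    case (insert k J)
    then have "axis k (x $ k) + (\<Sum>j\<in>J. axis j (x $ j)) \<in> hilbert_sum H"
      using mem[of k] by (simp add: hilbert_sum_def hs_add[OF H])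
    then show ?case using insert op_add[OF A mem[of k]] by simp
  qed
  moreover have "(\<Sum>j\<in>UNIV. axis j (x $ j)) = x"
    by (simp add: vec_eq_iff axis_def)
  ultimately have "A x = (\<Sum>j\<in>UNIV. A (axis j (x $ j)))" by metis
  then show ?thesis by (simp add: op_entry_def)
qed

text \<open>Entrywise domination by a real matrix passes to numerical radii: replace a unit vector by the
  vector of the norms of its components. For the diagonal entries only the quadratic form has to be
  dominated.\<close>

lemma numerical_radius_le_matrix:
  fixes H :: "'n::finite \<Rightarrow> 'a::complex_hilbert set" and m :: "'n \<Rightarrow> 'n \<Rightarrow> real"
  assumes H: "\<And>i. hilbert_subspace (H i)" and A: "bounded_op (hilbert_sum H) (hilbert_sum H) A"
    and dom: "\<And>i j x y. x \<in> H j \<Longrightarrow> y \<in> H i \<Longrightarrow> (i = j \<longrightarrow> x = y) \<Longrightarrow>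
      cmod (cinner (op_entry A i j x) y) \<le> m i j * (norm x * norm y)"
  shows "numerical_radius (hilbert_sum H) A \<le>
    numerical_radius UNIV ((*v) (\<chi> i j. complex_of_real (m i j)))"
proof -
  let ?M = "\<chi> i j. complex_of_real (m i j)"
  have le: "cmod (cinner (A x) x) \<le> numerical_radius UNIV ((*v) ?M)"
    if x: "x \<in> hilbert_sum H" "norm x = 1" for x
  proof -
    define s where "s = (\<Sum>i\<in>UNIV. \<Sum>j\<in>UNIV. m i j * (norm (x $ j) * norm (x $ i)))"
    define u :: "complex ^ 'n" where "u = (\<chi> i. complex_of_real (norm (x $ i)))"
    have cinner_sum: "cinner (\<Sum>j\<in>J. h j) y = (\<Sum>j\<in>J. cinner (h j) y)"
      for J :: "'n set" and h :: "'n \<Rightarrow> 'a" and y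
      using finite[of J]
      by (induction J rule: finite_induct)
        (use cinner_scaleC_left[of 0 "0 :: 'a" y] in \<open>simp_all add: cinner_add_left\<close>)
    have "cinner (A x) x = (\<Sum>i\<in>UNIV. \<Sum>j\<in>UNIV. cinner (op_entry A i j (x $ j)) (x $ i))"
      by (simp add: cinner_vec_def op_matrix_apply[OF H A x(1)] cinner_sum)
    also have "cmod \<dots> \<le> s"
      unfolding s_def using x(1)
      by (intro order_trans[OF norm_sum] sum_mono dom) (auto simp: hilbert_sum_def)
    also have "cinner (?M *v u) u = complex_of_real s"
      by (simp add: cinner_vec_def cinner_complex_def u_def s_def matrix_vector_mult_def
          sum_distrib_right sum_distrib_left mult_ac)
    then have "s \<le> cmod (cinner (?M *v u) u)" by simp
    also have "\<dots> \<le> numerical_radius UNIV ((*v) ?M)"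
      using x(2) by (intro numerical_radius_upper bounded_op_matrix)
        (simp_all add: norm_vec_def u_def)
    finally show ?thesis .
  qed
  have "0 \<le> numerical_radius UNIV ((*v) ?M)"
  proof -
    define k :: 'n where "k = undefined"
    have "cmod (cinner (?M *v axis k 1) (axis k 1)) \<le> numerical_radius UNIV ((*v) ?M)"
      by (intro numerical_radius_upper bounded_op_matrix) (simp_all add: norm_axis)
    then show ?thesis by (meson norm_ge_zero order_trans)
  qed
  then show ?thesis
    unfolding numerical_radius_def[of "hilbert_sum H" A] using le by (intro cSup_least) auto
qed

theorem theorem2:
  fixes H :: "'n::finite \<Rightarrow> 'a::complex_hilbert set"
    and A :: "'a ^ 'n \<Rightarrow> 'a ^ 'n"
    and f g :: "real \<Rightarrow> real"
  assumes "\<And>i. hilbert_subspace (H i)"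
    and "bounded_op (hilbert_sum H) (hilbert_sum H) A"
    and "continuous_on {0..} f" and "continuous_on {0..} g"
    and "\<And>t. t \<ge> 0 \<Longrightarrow> f t \<ge> 0" and "\<And>t. t \<ge> 0 \<Longrightarrow> g t \<ge> 0"
    and "\<And>t. t \<ge> 0 \<Longrightarrow> f t * g t = t"
  shows "numerical_radius (hilbert_sum H) A \<le>
    numerical_radius UNIV ((*v) (\<chi> i j. complex_of_real
      (if i = j then 1 / 4 * diag_bound (H i) f g (op_entry A i i)
       else op_norm (H j) (op_entry A i j))))"
proof (rule numerical_radius_le_matrix[OF assms(1,2)])
  fix i j x y assume x: "x \<in> H j" and y: "y \<in> H i" and xy: "i = j \<longrightarrow> x = y"
  note entry = bounded_op_entry[of H, OF assms(1,2)]
  show "cmod (cinner (op_entry A i j x) y) \<le>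
    (if i = j then 1 / 4 * diag_bound (H i) f g (op_entry A i i)
     else op_norm (H j) (op_entry A i j)) * (norm x * norm y)"
  proof (cases "i = j")
    case True
    then show ?thesis
      using cmod_cinner_le_diag_bound[OF assms(1) entry assms(3,4,7) y] xy
      by (simp add: power2_eq_square)
  next
    case False
    have "cmod (cinner (op_entry A i j x) y) \<le> norm (op_entry A i j x) * norm y"
      by (rule cmod_cinner_le)
    also have "\<dots> \<le> op_norm (H j) (op_entry A i j) * norm x * norm y"
      by (rule mult_right_mono[OF op_norm_bound[OF assms(1) entry x]]) simp
    finally show ?thesis using False by (simp add: mult.assoc)
  qed
qed

end
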